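(* Let $d\ge1$ and $(p,q_1,q_2)\in[0,1]^3$. There exist nearest-neighbor random walks $S$, $\tilde S^{(q_1)}$ and $\tilde S^{(q_2)}$ on $\mathbb{Z}^d$, defined on the same probability space, such that the following hold. (i) $S$ is a multi-dimensional elephant random walk (MERW) with parameter $p$, and $\tilde S^{(q_1)}$, $\tilde S^{(q_2)}$ are $d$-elephant random walks ($d$-ERWs) with pairs of parameters $(p,q_1)$ and $(p,q_2)$, respectively. (ii) Let $\sigma_n:=S_n-S_{n-1}$ and $\tilde\sigma^{(q_k)}_n:=\tilde S^{(q_k)}_n-\tilde S^{(q_k)}_{n-1}$, $k=1,2$. For every $n\ge1$ and $i\in\{1,\dots,d\}$, $$\sigma_n\in\{e_i,-e_i\}\iff\tilde\sigma^{(q_1)}_n\in\{e_i,-e_i\}\iff\tilde\sigma^{(q_2)}_n\in\{e_i,-e_i\}.$$ Equivalently, $b_n(i)=\tilde b^{(q_1)}_n(i)=\tilde b^{(q_2)}_n(i)$ for all $n\ge 1$ and $i$, where $b_n(i):=\#\{1\le j\le n:\sigma_j\in\{e_i,-e_i\}\}$ and $\tilde b^{(q_k)}_n(i):=\#\{1\le j\le n:\tilde\sigma^{(q_k)}_j\in\{e_i,-e_i\}\}$. (iii) For every $n\ge1$ and $k\in\{1,2\}$, conditionally on $\{b_m(i)\}_{1\le i\le d,\,1\le m\le n}=\{a_m(i)\}_{1\le i\le d,\,1\le m\le n}$, the law of $(\tilde S^{(q_k)}_m)_{1\le m\le n}$ is that of $$\left(\left(X^{(1)}_{a_m(1)},X^{(2)}_{a_m(2)},\dots,X^{(d)}_{a_m(d)}\right)\right)_{1\le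 m\le n},$$ where $X^{(1)},\dots,X^{(d)}$ are independent one-dimensional elephant random walks with common parameter $q_k$, with $X^{(1)}_1=1$ and, for $i\ne1$, $X^{(i)}_1$ equal to $+1$ or $-1$ with probability $1/2$ each. (iv) If $p\le\frac1{2d}$, $q_1\in\left[0,\frac{(2d-1)p}{2dp-2p+1}\right]$ and $q_2=\frac12$, then $$|\tilde S^{(q_1)}_n(i)|\le|S_n(i)|\le|\tilde S^{(q_2)}_n(i)|\qquad\text{for all }i\in\{1,\dots,d\},\ n\ge0 .$$ The same inequalities hold if $p\ge\frac1{2d}$, $q_1=\frac12$ and $q_2\in\left[\frac{(2d-1)p}{2dp-2p+1},1\right]$. (v) If $q_1\le q_2$, then $|\tilde S^{(q_1)}_n(i)|\le|\tilde S^{(q_2)}_n(i)|$ for all $i\in\{1,\dots,d\}$, $n\ge0$.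
   Context: $x(i)$ denotes the $i$-th coordinate of a vector $x$, and $e_1,\dots,e_d$ is the standard basis of $\mathbb{R}^d$. MERW on $\mathbb{Z}^d$ with parameter $p\in[0,1]$: $S_0=0$, $S_1=\sigma_1=e_1$. For each $n\ge 1$, choose $n'$ uniformly at random in $\{1,\dots,n\}$ (independently of the past); given the past and $n'$, let $\sigma_{n+1}=\sigma_{n'}$ with probability $p$, and $\sigma_{n+1}=\sigma$ with probability $\frac{1-p}{2d-1}$ for each $\sigma\in\{\pm e_1,\dots,\pm e_d\}\setminus\{\sigma_{n'}\}$. Set $S_{n+1}=S_n+\sigma_{n+1}$. One-dimensional elephant random walk $X$ with parameter $q\in[0,1]$: $X_0=0$, $X_1\in\{1,-1\}$ is a given (possibly random) first step (by default $X_1=1$), and for each $n\ge1$ the step $X_{n+1}-X_n$ equals, for a uniformly chosen $n'\in\{1,\dots,n\}$, the step $X_{n'}-X_{n'-1}$ with probability $q$ and its opposite with probability $1-q$ (this is the MERW with $d=1$, up to the choice of the first step). $d$-elephant random walk ($d$-ERW) with pair of parameters $(p,q)\in[0,1]^2$: a nearest-neighbor walk $(\tilde S_n)_{n\ge0}$ on $\mathbb{Z}^d$ with $\tilde S_0=0$, $\tilde S_1=\tilde\sigma_1=e_1$. For $n\ge1$ let $\tilde b_n(i):=\#\{1\le j\le n:\tilde\sigma_j\in\{e_i,-e_i\}\}$ and $$\tilde c_n(i):=\frac{2dp-1}{2d-1}\frac{\tilde b_n(i)}n+\frac{2-2p}{2d-1},\qquad i=1,\dots,d$$ (so that $\sum_i\tilde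 c_n(i)=1$). Given $\tilde S_0,\dots,\tilde S_n=\tilde x$, the next step $\tilde\sigma_{n+1}$ has conditional law $$\mathbb{P}(\tilde\sigma_{n+1}=\pm e_i)=\tilde c_n(i)\left(\frac12\pm\frac{(2q-1)\tilde x(i)}{2\tilde b_n(i)}\mathbf 1_{\{\tilde b_n(i)\ne0\}}\right),\quad i=1,\dots,d,$$ and $\tilde S_{n+1}=\tilde S_n+\tilde\sigma_{n+1}$. *)

theory Defs
  imports "HOL-Probability.Probability"
begin

text \<open>
  The lattice is \<open>int ^ 'd\<close>, with \<open>d = CARD('d)\<close> and \<open>e\<^sub>i = axis i 1\<close>.  Which coordinate is called
  the first one is an arbitrary parameter \<open>i1 :: 'd\<close>.
\<close>

definition axis_dirs :: "'d \<Rightarrow> (int ^ 'd) set"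
  where "axis_dirs i = {axis i 1, - axis i 1}"

definition unit_steps :: "(int ^ 'd) set"
  where "unit_steps = (\<Union>i. axis_dirs i)"

definition nearest_neighbour :: "'a measure \<Rightarrow> (nat \<Rightarrow> 'a \<Rightarrow> int ^ 'd) \<Rightarrow> bool"
  where "nearest_neighbour M S \<longleftrightarrow> (\<forall>\<omega>\<in>space M. \<forall>n. S (Suc n) \<omega> - S n \<omega> \<in> unit_steps)"

text \<open>\<open>axis_count s n i\<close> is the number of steps of the path \<open>s\<close> along axis \<open>i\<close> up to time \<open>n\<close>.\<close>

definition axis_count :: "(nat \<Rightarrow> int ^ 'd) \<Rightarrow> nat \<Rightarrow> 'd \<Rightarrow> nat"
  where "axis_count s n i = card {j \<in> {1..n}. s j - s (j - 1) \<in> axis_dirs i}"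

text \<open>
  Here \<open>\<nu> n\<close> is the time \<open>n'\<close> recalled when making step \<open>n + 1\<close>, and \<open>m\<close> is a prescribed sequence
  of values for the recalled times; the past at time \<open>n\<close> consists of the positions up to time \<open>n\<close> and of
  all earlier recalled times.  All variables are discrete, so conditional laws are given by
  elementary conditional probabilities on pasts of positive probability.

  In \<open>memory_walk M V K S\<close>, \<open>V\<close> is the set of admissible steps and \<open>K \<tau> v\<close> is the probability
  of making the step \<open>v\<close> when the recalled step is \<open>\<tau>\<close>.
\<close>

definition has_past ::
    "(nat \<Rightarrow> 'a \<Rightarrow> 'v) \<Rightarrow> (nat \<Rightarrow> 'a \<Rightarrow> nat) \<Rightarrow> nat \<Rightarrow> (nat \<Rightarrow> 'v) \<Rightarrow> (nat \<Rightarrow> nat) \<Rightarrow> 'a \<Rightarrow> bool"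
  where "has_past S \<nu> n s m \<omega> \<longleftrightarrow>
    (\<forall>j\<le>n. S j \<omega> = s j) \<and> (\<forall>j. 1 \<le> j \<and> j < n \<longrightarrow> \<nu> j \<omega> = m j)"

definition memory_walk ::
    "'a measure \<Rightarrow> 'v set \<Rightarrow> ('v \<Rightarrow> 'v \<Rightarrow> real) \<Rightarrow> (nat \<Rightarrow> 'a \<Rightarrow> 'v::ab_group_add) \<Rightarrow> bool"
  where "memory_walk M V K S \<longleftrightarrow>
    (\<exists>\<nu> :: nat \<Rightarrow> 'a \<Rightarrow> nat.
      (\<forall>n. \<nu> n \<in> measurable M (count_space UNIV)) \<and>
      (\<forall>n\<ge>1. \<forall>s m. \<P>(\<omega> in M. has_past S \<nu> n s m \<omega>) > 0 \<longrightarrow>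
        (\<forall>k\<in>{1..n}.
          \<P>(\<omega> in M. \<nu> n \<omega> = k \<bar> has_past S \<nu> n s m \<omega>) = 1 / real n \<and>
          (\<forall>v\<in>V. \<P>(\<omega> in M. S (Suc n) \<omega> - S n \<omega> = v \<bar> has_past S \<nu> n s m \<omega> \<and> \<nu> n \<omega> = k)
                  = K (s k - s (k - 1)) v))))"

definition merw :: "'a measure \<Rightarrow> 'd::finite \<Rightarrow> real \<Rightarrow> (nat \<Rightarrow> 'a \<Rightarrow> int ^ 'd) \<Rightarrow> bool"
  where "merw M i1 p S \<longleftrightarrow>
    (\<forall>n. S n \<in> measurable M (count_space UNIV)) \<and>
    (\<forall>\<omega>\<in>space M. S 0 \<omega> = 0 \<and> S 1 \<omega> = axis i1 1) \<and>
    memory_walk M unit_steps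
      (\<lambda>\<tau> v. if v = \<tau> then p else (1 - p) / (2 * real CARD('d) - 1)) S"

definition erw :: "'a measure \<Rightarrow> real \<Rightarrow> (nat \<Rightarrow> 'a \<Rightarrow> int) \<Rightarrow> bool"
  where "erw M q X \<longleftrightarrow>
    (\<forall>n. X n \<in> measurable M (count_space UNIV)) \<and>
    (\<forall>\<omega>\<in>space M. X 0 \<omega> = 0 \<and> X 1 \<omega> \<in> {1, -1}) \<and>
    memory_walk M {1, -1} (\<lambda>\<tau> v. if v = \<tau> then q else 1 - q) X"

text \<open>The quantity \<open>\<tilde>c\<^sub>n(i)\<close>, as a function of the past path \<open>s\<close>.\<close>

definition axis_prob :: "real \<Rightarrow> (nat \<Rightarrow> int ^ 'd::finite) \<Rightarrow> nat \<Rightarrow> 'd \<Rightarrow> real"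
  where "axis_prob p s n i =
    (2 * real CARD('d) * p - 1) / (2 * real CARD('d) - 1) * (real (axis_count s n i) / real n)
    + (2 - 2 * p) / (2 * real CARD('d) - 1)"

definition sign_bias :: "real \<Rightarrow> (nat \<Rightarrow> int ^ 'd::finite) \<Rightarrow> nat \<Rightarrow> 'd \<Rightarrow> real"
  where "sign_bias q s n i =
    (if axis_count s n i \<noteq> 0
     then (2 * q - 1) * of_int (s n $ i) / (2 * real (axis_count s n i)) else 0)"

definition d_erw ::
    "'a measure \<Rightarrow> 'd::finite \<Rightarrow> real \<Rightarrow> real \<Rightarrow> (nat \<Rightarrow> 'a \<Rightarrow> int ^ 'd) \<Rightarrow> bool"
  where "d_erw M i1 p q S \<longleftrightarrow>
    (\<forall>n. S n \<in> measurable M (count_space UNIV)) \<and>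
    (\<forall>\<omega>\<in>space M. S 0 \<omega> = 0 \<and> S 1 \<omega> = axis i1 1) \<and>
    nearest_neighbour M S \<and>
    (\<forall>n\<ge>1. \<forall>s. \<P>(\<omega> in M. \<forall>j\<le>n. S j \<omega> = s j) > 0 \<longrightarrow>
      (\<forall>i. \<P>(\<omega> in M. S (Suc n) \<omega> - S n \<omega> = axis i 1 \<bar> \<forall>j\<le>n. S j \<omega> = s j)
             = axis_prob p s n i * (1 / 2 + sign_bias q s n i) \<and>
           \<P>(\<omega> in M. S (Suc n) \<omega> - S n \<omega> = - axis i 1 \<bar> \<forall>j\<le>n. S j \<omega> = s j)
             = axis_prob p s n i * (1 / 2 - sign_bias q s n i)))"

definition independent_erws ::
    "'b measure \<Rightarrow> 'd::finite \<Rightarrow> real \<Rightarrow> ('d \<Rightarrow> nat \<Rightarrow> 'b \<Rightarrow> int) \<Rightarrow> bool"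
  where "independent_erws N i1 q X \<longleftrightarrow>
    prob_space N \<and>
    (\<forall>i. erw N q (X i)) \<and>
    prob_space.indep_vars N (\<lambda>i. Pi\<^sub>M UNIV (\<lambda>n::nat. count_space UNIV)) (\<lambda>i \<omega> n. X i n \<omega>) UNIV \<and>
    (\<forall>\<omega>\<in>space N. X i1 1 \<omega> = 1) \<and>
    (\<forall>i. i \<noteq> i1 \<longrightarrow>
      \<P>(\<omega> in N. X i 1 \<omega> = 1) = 1 / 2 \<and> \<P>(\<omega> in N. X i 1 \<omega> = - 1) = 1 / 2)"

text \<open>
  \<open>counts_event M S n a\<close> is the event that the axis counts of \<open>S\<close> at times \<open>1, \<dots>, n\<close>
  are given by \<open>a\<close>.
\<close>

definition counts_event ::
    "'a measure \<Rightarrow> (nat \<Rightarrow> 'a \<Rightarrow> int ^ 'd) \<Rightarrow> nat \<Rightarrow> (nat \<Rightarrow> 'd \<Rightarrow> nat) \<Rightarrow> 'a set"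
  where "counts_event M S n a =
    {\<omega> \<in> space M. \<forall>m\<in>{1..n}. \<forall>i. axis_count (\<lambda>j. S j \<omega>) m i = a m i}"

end

theory Submission
  imports Defs
begin

text \<open>
  All randomness comes from one sequence of independent uniform numbers, and everything rests on two
  choices of how it is spent.

  Axes and signs are separated. In the MERW the chance that the next step runs along axis \<open>i\<close>
  depends on the past only through the number \<open>b\<close> of earlier steps along \<open>i\<close>, and it is exactly
  the quantity that defines the \<open>d\<close>-ERW. Hence one process of axes serves all three walks. Given
  the axis, a walk at coordinate \<open>x\<close> moves up with probability \<open>1/2 + h\<close>, where \<open>h = (2 * q - 1) * x / (2 * b)\<close> for a
  \<open>d\<close>-ERW and \<open>h = \<alpha> * x / (2 * (\<alpha> * b + \<gamma> * n))\<close> for the MERW. The function \<open>walk\<close> builds such a walk for an arbitrary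
  bias \<open>h\<close>, and its one-step law is \<open>walk_path_law\<close>.

  The uniform number that decides the sign is indexed by the axis and by how often that axis has
  been used, instead of by time. Along each axis the signs of a \<open>d\<close>-ERW then form a one-dimensional
  elephant walk that does not look at the axis process, and the identity
  \<open>walk_erw_nth\<close> says that coordinate \<open>i\<close> of the \<open>d\<close>-ERW is that elephant walk run at the clock
  \<open>b\<close>. Conditioning on the counts only freezes an independent clock, which is the description of the
  conditional law (\<open>distr_walk_given_counts\<close>), with the elephant walks living on the same space.

  All walks compare the same uniform number with their own probability of moving away from the
  origin. Their coordinates have equal parity, so absolute values that differ do so by at least 2 and
  cannot cross in one step; when they agree, the walk with the larger outward bias stays on top
  (\<open>turn_outward_mono\<close>, \<open>abs_walk_mono\<close>). The inequalities between the walks thus reduce to inequalities between the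
  biases. The constant \<open>(2 * d - 1) * p / (2 * d * p - 2 * p + 1)\<close> is the \<open>q\<close> with \<open>2 * q - 1 = \<alpha> / (\<alpha> + \<gamma>)\<close>, the extreme case
  \<open>b = n\<close> of the MERW bias.

  The definition of a walk with memory also asks for the recalled times. They are chosen
  after the step has been made, from their conditional law given the path, with
  fresh uniform numbers. By Bayes' rule this gives the same joint law as recalling first and stepping
  afterwards, and the only input is the law of the path itself (\<open>memory_walkI\<close>).
\<close>

section \<open>Uniform noise\<close>

definition unif :: "real measure"
  where "unif = uniform_measure lborel {0<..<1}"

lemma prob_space_unif: "prob_space unif"
  unfolding unif_def by (rule prob_space_uniform_measure) auto

lemma sets_unif [simp, measurable_cong]: "sets unif = sets borel"
  by (simp add: unif_def)

lemma space_unif [simp]: "space unif = UNIV"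
  by (simp add: unif_def)

lemma measure_unif: "A \<in> sets borel \<Longrightarrow> measure unif A = measure lborel ({0<..<1} \<inter> A)"
  by (simp add: unif_def)

lemma measure_unif_less:
  assumes "0 \<le> t" "t \<le> 1"
  shows "measure unif {u. u < t} = t"
proof -
  have "{0<..<1} \<inter> {u. u < t} = {0<..<t}"
    using assms by auto
  moreover have "measure unif {u. u < t} = measure lborel ({0<..<1} \<inter> {u. u < t})"
    by (rule measure_unif) measurable
  ultimately show ?thesis
    using assms by simp
qed

text \<open>
  The pseudo-inverse of the distribution function turns a uniform number into a real random
  variable of given law. A discrete law is first carried to the reals by an enumeration of its
  support.
\<close>

lemma ex_quantile:
  fixes \<mu> :: "'a pmf"
  shows "\<exists>g \<in> borel \<rightarrow>\<^sub>M count_space UNIV. \<forall>a. measure unif {u. g u = a} = pmf \<mu> a"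
proof -
  define h where "h a = real (to_nat_on (set_pmf \<mu>) a)" for a
  define D where "D = distr (measure_pmf \<mu>) borel h"
  interpret D: cdf_distribution D
    unfolding cdf_distribution_def D_def
    by (rule prob_space.real_distribution_distr[OF measure_pmf.prob_space_axioms]) simp
  define J where "J u = (if u \<in> {0<..<1} then D.I u else 0)" for u
  define g where "g u = from_nat_into (set_pmf \<mu>) (nat \<lfloor>J u\<rfloor>)" for u
  have J [measurable]: "J \<in> borel_measurable borel"
    using D.measurable_CI unfolding J_def
    by (subst (asm) measurable_restrict_space_iff[where c = 0]) auto
  have g [measurable]: "g \<in> borel \<rightarrow>\<^sub>M count_space UNIV"
    unfolding g_def by measurable
  have "measure unif {u. g u = a} = pmf \<mu> a" for a
  proof -
    have "measure unif {u. g u = a} = measure lborel ({0<..<1} \<inter> {u. g u = a})"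
      by (rule measure_unif) measurable
    also have "\<dots> = measure (distr (restrict_space lborel {0<..<1}) borel D.I) {x. from_nat_into (set_pmf \<mu>) (nat \<lfloor>x\<rfloor>) = a}"
      by (subst measure_distr)
         (auto simp: space_restrict_space measure_restrict_space g_def J_def intro!: arg_cong2[where f = measure])
    also have "\<dots> = measure (measure_pmf \<mu>) {b. from_nat_into (set_pmf \<mu>) (nat \<lfloor>h b\<rfloor>) = a}"
      unfolding D.distr_I_eq_M unfolding D_def by (subst measure_distr) (auto simp: vimage_def)
    also have "\<dots> = measure (measure_pmf \<mu>) {a}"
      by (rule measure_pmf.finite_measure_eq_AE) (auto simp: AE_measure_pmf_iff h_def)
    finally show ?thesis by (simp add: pmf.rep_eq)
  qed
  with g show ?thesis by (intro bexI[of _ g] allI)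
qed

definition quantile :: "'a pmf \<Rightarrow> real \<Rightarrow> 'a"
  where "quantile \<mu> = (SOME g. g \<in> borel \<rightarrow>\<^sub>M count_space UNIV \<and> (\<forall>a. measure unif {u. g u = a} = pmf \<mu> a))"

lemma measurable_quantile [measurable]: "quantile \<mu> \<in> borel \<rightarrow>\<^sub>M count_space UNIV"
  and measure_quantile: "measure unif {u. quantile \<mu> u = a} = pmf \<mu> a"
  using someI_ex[OF ex_quantile[of \<mu>, unfolded Bex_def]] unfolding quantile_def by auto

lemma pmf_embed_pmf_finite:
  fixes f :: "'a \<Rightarrow> real"
  assumes "finite A" "\<And>x. x \<in> A \<Longrightarrow> f x \<ge> 0" "sum f A = 1"
  shows "pmf (embed_pmf (\<lambda>x. if x \<in> A then f x else 0)) a = (if a \<in> A then f a else 0)"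
proof (rule pmf_embed_pmf)
  show "(\<integral>\<^sup>+ x. ennreal (if x \<in> A then f x else 0) \<partial>count_space UNIV) = 1"
    using assms by (subst nn_integral_count_space'[of A]) (auto simp: sum_ennreal)
qed (use assms in auto)

abbreviation noise :: "(nat \<Rightarrow> real) measure"
  where "noise \<equiv> Pi\<^sub>M UNIV (\<lambda>_. unif)"

interpretation noise: product_prob_space "\<lambda>_::nat. unif" UNIV
  by (intro product_prob_spaceI prob_space_unif)

lemma space_noise [simp]: "space noise = UNIV"
  by (simp add: space_PiM)

lemma measure_noise_coord:
  assumes "A \<in> sets borel"
  shows "measure noise {\<omega>. \<omega> n \<in> A} = measure unif A"
proof -
  have "measure noise {\<omega>. \<omega> n \<in> A} = measure (distr noise unif (\<lambda>\<omega>. \<omega> n)) A"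
    using assms by (subst measure_distr) (auto simp: vimage_def)
  also have "distr noise unif (\<lambda>\<omega>. \<omega> n) = unif"
    by (rule distr_PiM_component) (auto intro: prob_space_unif)
  finally show ?thesis .
qed

lemma indep_vars_noise: "noise.P.indep_vars (\<lambda>_. unif) (\<lambda>n \<omega>. \<omega> n) UNIV"
proof -
  have "distr noise unif (\<lambda>\<omega>. \<omega> n) = unif" for n
    by (rule distr_PiM_component) (auto intro: prob_space_unif)
  then show ?thesis
    by (subst noise.P.indep_vars_iff_distr_eq_PiM') (auto simp: restrict_def)
qed

lemma measurable_noise_coord [measurable]: "(\<lambda>\<omega>. \<omega> j) \<in> noise \<rightarrow>\<^sub>M borel"
  using measurable_component_singleton[of j UNIV "\<lambda>_. unif"]
  by (simp add: measurable_cong_sets[OF refl sets_unif])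

lemma measurable_quantile_coord [measurable]:
  "(\<lambda>\<omega>. quantile \<mu> (\<omega> j)) \<in> noise \<rightarrow>\<^sub>M count_space UNIV"
  by (rule measurable_compose[OF measurable_noise_coord measurable_quantile])

text \<open>
  Events are described by the coordinates that can influence them. This is coarser than
  measurability with respect to those coordinates, but for measurable events both agree, and it can be
  checked by substituting one noise for another in a recursion.
\<close>

definition depends_on :: "nat set \<Rightarrow> (nat \<Rightarrow> real) set \<Rightarrow> bool"
  where "depends_on J E \<longleftrightarrow> (\<forall>\<omega>\<in>E. \<forall>\<omega>'. (\<forall>j\<in>J. \<omega>' j = \<omega> j) \<longrightarrow> \<omega>' \<in> E)"

lemma depends_onI:
  assumes "\<And>\<omega> \<omega>'. \<omega> \<in> E \<Longrightarrow> (\<And>j. j \<in> J \<Longrightarrow> \<omega>' j = \<omega> j) \<Longrightarrow> \<omega>' \<in> E"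
  shows "depends_on J E"
  using assms unfolding depends_on_def by blast

lemma depends_onD:
  assumes "depends_on J E" "\<omega> \<in> E" "\<And>j. j \<in> J \<Longrightarrow> \<omega>' j = \<omega> j"
  shows "\<omega>' \<in> E"
  using assms unfolding depends_on_def by simp

lemma depends_on_Int:
  assumes "depends_on J A" "depends_on K B"
  shows "depends_on (J \<union> K) (A \<inter> B)"
  by (rule depends_onI) (auto intro: depends_onD[OF assms(1)] depends_onD[OF assms(2)])

text \<open>
  A section of the restriction to \<open>J\<close>: an event that depends on \<open>J\<close> only is the preimage, under the
  restriction, of its own preimage under this map. The value outside \<open>J\<close> is arbitrary.
\<close>

definition extend0 :: "nat set \<Rightarrow> (nat \<Rightarrow> real) \<Rightarrow> nat \<Rightarrow> real"
  where "extend0 J x = (\<lambda>j. if j \<in> J then x j else 0)"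

lemma measurable_extend0 [measurable]: "extend0 J \<in> Pi\<^sub>M J (\<lambda>_. unif) \<rightarrow>\<^sub>M noise"
proof -
  have "(\<lambda>\<omega>. if j \<in> J then \<omega> j else 0) \<in> Pi\<^sub>M J (\<lambda>_. unif) \<rightarrow>\<^sub>M unif" for j
    by (cases "j \<in> J") (auto intro: measurable_component_singleton)
  then show ?thesis
    unfolding extend0_def by (intro measurable_PiM_single') (auto simp: space_PiM)
qed

lemma prob_indep:
  assumes A: "A \<in> sets noise" "depends_on J A" and B: "B \<in> sets noise" "depends_on K B"
    and "J \<inter> K = {}"
  shows "noise.P.prob (A \<inter> B) = noise.P.prob A * noise.P.prob B"
proof -
  have *: "(\<lambda>\<omega>. restrict (\<lambda>j. \<omega> j) J) -` (extend0 J -` A \<inter> space (Pi\<^sub>M J (\<lambda>_. unif))) = A"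
    if "depends_on J A" for J A
  proof -
    have "extend0 J (restrict \<omega> J) \<in> A \<longleftrightarrow> \<omega> \<in> A" for \<omega>
      using that unfolding depends_on_def
      by (metis extend0_def restrict_apply')
    then show ?thesis by (auto simp: space_PiM)
  qed
  have "noise.P.indep_var (Pi\<^sub>M J (\<lambda>_. unif)) (\<lambda>\<omega>. restrict (\<lambda>j. \<omega> j) J)
                          (Pi\<^sub>M K (\<lambda>_. unif)) (\<lambda>\<omega>. restrict (\<lambda>j. \<omega> j) K)"
    by (rule noise.P.indep_var_restrict[OF indep_vars_noise]) (use assms in auto)
  from noise.P.indep_varD[OF this measurable_sets[OF measurable_extend0 A(1)]
      measurable_sets[OF measurable_extend0 B(1)]]
  show ?thesis
    using *[OF A(2)] *[OF B(2)] by (simp add: vimage_Times comp_def)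
qed

section \<open>Recalled times chosen after the step\<close>

lemma measurable_discrete2:
  fixes f :: "'a \<Rightarrow> 'b::countable"
  assumes "f \<in> M \<rightarrow>\<^sub>M count_space UNIV" "g \<in> M \<rightarrow>\<^sub>M count_space UNIV"
  shows "(\<lambda>x. h (f x) (g x)) \<in> M \<rightarrow>\<^sub>M count_space UNIV"
  by (rule measurable_compose_countable[OF measurable_compose[OF assms(2)] assms(1)]) simp

lemma measurable_map_discrete:
  fixes S :: "'i \<Rightarrow> 'a \<Rightarrow> 'b::countable"
  assumes "\<And>j. S j \<in> M \<rightarrow>\<^sub>M count_space UNIV"
  shows "(\<lambda>x. map (\<lambda>j. S j x) js) \<in> M \<rightarrow>\<^sub>M count_space UNIV"
  by (induction js) (auto intro: measurable_discrete2[OF assms])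

text \<open>
  The conditional law of the recalled time given the path \<open>s\<close> up to time \<open>n + 1\<close>: a priori the
  time is uniform, and recalling \<open>k\<close> makes the observed step with probability \<open>w k\<close>. When all the
  \<open>w k\<close> vanish the observed step has probability zero, and any law will do.
\<close>

definition recall_pmf :: "('v::ab_group_add \<Rightarrow> 'v \<Rightarrow> real) \<Rightarrow> nat \<Rightarrow> (nat \<Rightarrow> 'v) \<Rightarrow> nat pmf"
  where "recall_pmf K n s =
    (let w = (\<lambda>k. K (s k - s (k - 1)) (s (Suc n) - s n)); W = (\<Sum>k=1..n. w k)
     in embed_pmf (\<lambda>k. if k \<in> {1..n} then (if W = 0 then 1 / real n else w k / W) else 0))"

lemma recall_pmf_cong:
  assumes "\<And>j. j \<le> Suc n \<Longrightarrow> s j = t j"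
  shows "recall_pmf K n s = recall_pmf K n t"
proof -
  have "(\<Sum>k=1..n. K (s k - s (k - 1)) (s (Suc n) - s n)) = (\<Sum>k=1..n. K (t k - t (k - 1)) (t (Suc n) - t n))"
    using assms by (intro sum.cong) auto
  then show ?thesis
    unfolding recall_pmf_def Let_def using assms
    by (intro arg_cong[where f = embed_pmf] ext if_cong) auto
qed

text \<open>
  Multiplied out, Bayes' rule holds without exception for steps of probability zero.
\<close>

lemma pmf_recall:
  assumes "n \<ge> 1" and k: "k \<in> {1..n}"
    and K: "\<And>k. k \<in> {1..n} \<Longrightarrow> K (s k - s (k - 1)) (s (Suc n) - s n) \<ge> 0"
  shows "(\<Sum>k=1..n. K (s k - s (k - 1)) (s (Suc n) - s n)) * pmf (recall_pmf K n s) k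
       = K (s k - s (k - 1)) (s (Suc n) - s n)"
proof -
  define w where "w = (\<lambda>k. K (s k - s (k - 1)) (s (Suc n) - s n))"
  define W where "W = sum w {1..n}"
  have w: "k \<in> {1..n} \<Longrightarrow> w k \<ge> 0" for k
    using K by (simp add: w_def)
  have W: "W \<ge> 0" unfolding W_def by (rule sum_nonneg) (rule w)
  have "pmf (recall_pmf K n s) k
    = pmf (embed_pmf (\<lambda>k. if k \<in> {1..n} then (if W = 0 then 1 / real n else w k / W) else 0)) k"
    unfolding recall_pmf_def w_def W_def Let_def ..
  also have "\<dots> = (if k \<in> {1..n} then (if W = 0 then 1 / real n else w k / W) else 0)"
  proof (rule pmf_embed_pmf_finite)
    show "(\<Sum>k\<in>{1..n}. if W = 0 then 1 / real n else w k / W) = 1"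
      using assms(1) by (cases "W = 0") (simp_all add: sum_divide_distrib[symmetric], simp add: W_def)
  qed (use w W in auto)
  finally have pmf: "pmf (recall_pmf K n s) k = (if W = 0 then 1 / real n else w k / W)"
    using k by simp
  have "W * pmf (recall_pmf K n s) k = w k"
  proof (cases "W = 0")
    case True
    then have "w k = 0"
      using k w sum_nonneg_eq_0_iff[of "{1..n}" w] by (auto simp: W_def)
    then show ?thesis using True by simp
  qed (simp add: pmf)
  then show ?thesis by (simp add: w_def W_def)
qed

text \<open>
  The coordinates \<open>c n\<close> are reserved for the recalled times, and \<open>S\<close> does not see them. Given a
  path and its next step, the recalled times are then independent of each other and of the path, so
  the past together with the next step \<open>v\<close> and the recalled time \<open>k\<close> has probability equal to that of
  the past, times the mean of the kernel over all recalled times, times the conditional weight of \<open>k\<close>. The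
  last two factors multiply to \<open>K (s k - s (k - 1)) v / n\<close>, as they should.
\<close>

lemma memory_walkI:
  fixes S :: "nat \<Rightarrow> (nat \<Rightarrow> real) \<Rightarrow> 'v::{ab_group_add,countable}" and c :: "nat \<Rightarrow> nat"
  assumes c: "inj c" "J \<inter> range c = {}"
    and S [measurable]: "\<And>n. S n \<in> noise \<rightarrow>\<^sub>M count_space UNIV"
    and dep: "\<And>n \<omega> \<omega>'. (\<And>j. j \<in> J \<Longrightarrow> \<omega>' j = \<omega> j) \<Longrightarrow> S n \<omega>' = S n \<omega>"
    and V: "finite V" "\<And>n \<omega>. S (Suc n) \<omega> - S n \<omega> \<in> V"
    and K: "\<And>\<tau> v. \<tau> \<in> V \<Longrightarrow> v \<in> V \<Longrightarrow> K \<tau> v \<ge> 0" "\<And>\<tau>. \<tau> \<in> V \<Longrightarrow> sum (K \<tau>) V = 1"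
    and law: "\<And>n v \<omega>\<^sub>0. n \<ge> 1 \<Longrightarrow> v \<in> V \<Longrightarrow>
      \<P>(\<omega> in noise. (\<forall>j\<le>n. S j \<omega> = S j \<omega>\<^sub>0) \<and> S (Suc n) \<omega> - S n \<omega> = v)
      = \<P>(\<omega> in noise. \<forall>j\<le>n. S j \<omega> = S j \<omega>\<^sub>0)
        * ((\<Sum>k=1..n. K (S k \<omega>\<^sub>0 - S (k - 1) \<omega>\<^sub>0) v) / real n)"
  shows "memory_walk noise V K S"
proof -
  define \<nu> where "\<nu> n \<omega> = quantile (recall_pmf K n (\<lambda>j. S j \<omega>)) (\<omega> (c n))" for n \<omega>
  have \<nu> [measurable]: "\<nu> n \<in> noise \<rightarrow>\<^sub>M count_space UNIV" for n
  proof -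
    have "\<nu> n = (\<lambda>\<omega>. quantile (recall_pmf K n ((!) (map (\<lambda>j. S j \<omega>) [0..<n+2]))) (\<omega> (c n)))"
      unfolding \<nu>_def by (intro ext arg_cong2[where f = quantile] recall_pmf_cong) (auto simp del: upt_Suc)
    also have "\<dots> \<in> noise \<rightarrow>\<^sub>M count_space UNIV"
      by (rule measurable_compose_countable[OF _ measurable_map_discrete])
         (rule measurable_quantile_coord, rule S)
    finally show ?thesis .
  qed
  have step: "\<P>(\<omega> in noise. has_past S \<nu> n s m \<omega> \<and> \<nu> n \<omega> = k \<and> S (Suc n) \<omega> - S n \<omega> = v)
      = \<P>(\<omega> in noise. has_past S \<nu> n s m \<omega>) * (K (s k - s (k - 1)) v / real n)"
    if n: "n \<ge> 1" and k: "k \<in> {1..n}" and v: "v \<in> V" and pos: "\<P>(\<omega> in noise. has_past S \<nu> n s m \<omega>) > 0"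
    for n s m k v
  proof -
    obtain \<omega>\<^sub>0 where "has_past S \<nu> n s m \<omega>\<^sub>0"
      using pos by (metis (mono_tags, lifting) Collect_empty_eq measure_empty less_irrefl)
    then have \<omega>\<^sub>0: "s j = S j \<omega>\<^sub>0" if "j \<le> n" for j
      using that by (simp add: has_past_def)
    define s' where "s' = s(Suc n := s n + v)"
    define A where "A = {\<omega>\<in>space noise. \<forall>j\<le>n. S j \<omega> = s j}"
    define A' where "A' = {\<omega>\<in>space noise. (\<forall>j\<le>n. S j \<omega> = s j) \<and> S (Suc n) \<omega> - S n \<omega> = v}"
    define R where "R = {\<omega>\<in>space noise. \<forall>j. 1 \<le> j \<and> j < n \<longrightarrow> quantile (recall_pmf K j s) (\<omega> (c j)) = m j}"
    define B where "B = {\<omega>\<in>space noise. quantile (recall_pmf K n s') (\<omega> (c n)) = k}"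
    have [measurable]: "(\<lambda>\<omega>. S (Suc n) \<omega> - S n \<omega>) \<in> noise \<rightarrow>\<^sub>M count_space UNIV"
      by (rule measurable_discrete2[OF S S])
    have meas: "A \<in> sets noise" "A' \<in> sets noise" "R \<in> sets noise" "B \<in> sets noise"
      subgoal unfolding A_def by measurable
      subgoal unfolding A'_def by measurable
      subgoal unfolding R_def by measurable
      subgoal unfolding B_def by measurable
      done
    have depA: "depends_on J A" "depends_on J A'"
      subgoal
      proof (rule depends_onI)
        fix \<omega> \<omega>' assume "\<omega> \<in> A" and "\<And>j. j \<in> J \<Longrightarrow> \<omega>' j = \<omega> j"
        note eq = dep[of \<omega>' \<omega>, OF this(2)]
        show "\<omega>' \<in> A" using \<open>\<omega> \<in> A\<close> by (simp add: A_def eq)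
      qed
      subgoal
      proof (rule depends_onI)
        fix \<omega> \<omega>' assume "\<omega> \<in> A'" and "\<And>j. j \<in> J \<Longrightarrow> \<omega>' j = \<omega> j"
        note eq = dep[of \<omega>' \<omega>, OF this(2)]
        show "\<omega>' \<in> A'" using \<open>\<omega> \<in> A'\<close> by (auto simp: A'_def eq)
      qed
      done
    have depR: "depends_on (c ` {..<n}) R" "depends_on {c n} B"
      unfolding depends_on_def R_def B_def by auto
    have past: "has_past S \<nu> n s m \<omega> \<longleftrightarrow> \<omega> \<in> A \<inter> R" for \<omega>
    proof -
      have "recall_pmf K j (\<lambda>j. S j \<omega>) = recall_pmf K j s" if "\<omega> \<in> A" "j < n" for j
        using that by (intro recall_pmf_cong) (auto simp: A_def)
      then show ?thesis by (auto simp: has_past_def A_def R_def \<nu>_def)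
    qed
    have now: "has_past S \<nu> n s m \<omega> \<and> \<nu> n \<omega> = k \<and> S (Suc n) \<omega> - S n \<omega> = v \<longleftrightarrow> \<omega> \<in> (A' \<inter> R) \<inter> B" for \<omega>
    proof -
      have "recall_pmf K n (\<lambda>j. S j \<omega>) = recall_pmf K n s'" if "\<omega> \<in> A'"
        using that by (intro recall_pmf_cong) (auto simp: A'_def s'_def le_Suc_eq algebra_simps)
      then show ?thesis unfolding past by (auto simp: A_def A'_def \<nu>_def B_def)
    qed
    \<comment> \<open>Peel off the time recalled at \<open>n\<close>, then the earlier ones, apply the law of the path,
      and finally put the earlier ones back.\<close>
    have "noise.P.prob ((A' \<inter> R) \<inter> B) = noise.P.prob (A' \<inter> R) * noise.P.prob B"
    proof (rule prob_indep)
      show "depends_on (J \<union> c ` {..<n}) (A' \<inter> R)"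
        by (rule depends_on_Int[OF depA(2) depR(1)])
      show "(J \<union> c ` {..<n}) \<inter> {c n} = {}"
        using c by (auto dest: injD)
    qed (use meas depR in auto)
    also have "noise.P.prob (A' \<inter> R) = noise.P.prob A' * noise.P.prob R"
      by (rule prob_indep[OF meas(2) depA(2) meas(3) depR(1)]) (use c in auto)
    also have "noise.P.prob A' = noise.P.prob A * ((\<Sum>k=1..n. K (s k - s (k - 1)) v) / real n)"
    proof -
      have "(\<Sum>k=1..n. K (s k - s (k - 1)) v) = (\<Sum>k=1..n. K (S k \<omega>\<^sub>0 - S (k - 1) \<omega>\<^sub>0) v)"
        using \<omega>\<^sub>0 by (intro sum.cong) auto
      moreover have "A = {\<omega> \<in> space noise. \<forall>j\<le>n. S j \<omega> = S j \<omega>\<^sub>0}"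
        "A' = {\<omega> \<in> space noise. (\<forall>j\<le>n. S j \<omega> = S j \<omega>\<^sub>0) \<and> S (Suc n) \<omega> - S n \<omega> = v}"
        using \<omega>\<^sub>0 by (auto simp: A_def A'_def)
      ultimately show ?thesis
        using law[OF n v, of \<omega>\<^sub>0] by presburger
    qed
    also have "noise.P.prob B = pmf (recall_pmf K n s') k"
      unfolding B_def measure_quantile[symmetric]
      using measure_noise_coord[of "{u. quantile (recall_pmf K n s') u = k}" "c n"] by simp
    also have "noise.P.prob A * ((\<Sum>k=1..n. K (s k - s (k - 1)) v) / real n) * noise.P.prob R * pmf (recall_pmf K n s') k
      = (noise.P.prob A * noise.P.prob R) * (((\<Sum>k=1..n. K (s k - s (k - 1)) v) * pmf (recall_pmf K n s') k) / real n)"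
      by simp
    also have "(\<Sum>k=1..n. K (s k - s (k - 1)) v) * pmf (recall_pmf K n s') k = K (s k - s (k - 1)) v"
    proof -
      have "K (s' k - s' (k - 1)) (s' (Suc n) - s' n) = K (s k - s (k - 1)) v \<and> K (s k - s (k - 1)) v \<ge> 0"
        if "k \<in> {1..n}" for k
        using that V(2)[of "k - 1" \<omega>\<^sub>0] \<omega>\<^sub>0 v by (auto simp: s'_def intro: K(1))
      note same = this
      have sums: "(\<Sum>k=1..n. K (s' k - s' (k - 1)) (s' (Suc n) - s' n)) = (\<Sum>k=1..n. K (s k - s (k - 1)) v)"
        using same by (intro sum.cong) blast+
      have "(\<Sum>k=1..n. K (s' k - s' (k - 1)) (s' (Suc n) - s' n)) * pmf (recall_pmf K n s') k
          = K (s' k - s' (k - 1)) (s' (Suc n) - s' n)"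
        by (rule pmf_recall[OF n k]) (simp only: same)
      then show ?thesis
        unfolding sums by (simp only: same[OF k])
    qed
    also have "noise.P.prob A * noise.P.prob R = noise.P.prob (A \<inter> R)"
      by (rule prob_indep[symmetric, OF meas(1) depA(1) meas(3) depR(1)]) (use c in auto)
    finally have "noise.P.prob (A' \<inter> R \<inter> B) = noise.P.prob (A \<inter> R) * (K (s k - s (k - 1)) v / real n)"
      by simp
    moreover have "{\<omega> \<in> space noise. has_past S \<nu> n s m \<omega> \<and> \<nu> n \<omega> = k \<and> S (Suc n) \<omega> - S n \<omega> = v} = A' \<inter> R \<inter> B"
      unfolding now by auto
    moreover have "{\<omega> \<in> space noise. has_past S \<nu> n s m \<omega>} = A \<inter> R"
      unfolding past by auto
    ultimately show ?thesis by simp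
  qed
  show ?thesis
    unfolding memory_walk_def
  proof (intro exI[of _ \<nu>] conjI allI impI ballI)
    fix n :: nat and s m k
    assume n: "n \<ge> 1" and pos: "\<P>(\<omega> in noise. has_past S \<nu> n s m \<omega>) > 0" and k: "k \<in> {1..n}"
    have [measurable]: "Measurable.pred noise (has_past S \<nu> n s m)"
      unfolding has_past_def[abs_def] by measurable
    obtain \<omega>\<^sub>0 where "has_past S \<nu> n s m \<omega>\<^sub>0"
      using pos by (metis (mono_tags, lifting) Collect_empty_eq measure_empty less_irrefl)
    then have "s k - s (k - 1) \<in> V"
      using k V(2)[of "k - 1" \<omega>\<^sub>0] by (auto simp: has_past_def)
    note sumK = K(2)[OF this]
    have "\<P>(\<omega> in noise. has_past S \<nu> n s m \<omega> \<and> \<nu> n \<omega> = k)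
      = (\<Sum>v\<in>V. \<P>(\<omega> in noise. has_past S \<nu> n s m \<omega> \<and> \<nu> n \<omega> = k \<and> S (Suc n) \<omega> - S n \<omega> = v))"
    proof -
      have "{\<omega> \<in> space noise. has_past S \<nu> n s m \<omega> \<and> \<nu> n \<omega> = k}
        = (\<Union>v\<in>V. {\<omega> \<in> space noise. has_past S \<nu> n s m \<omega> \<and> \<nu> n \<omega> = k \<and> S (Suc n) \<omega> - S n \<omega> = v})"
        using V by auto
      moreover have "{\<omega> \<in> space noise. has_past S \<nu> n s m \<omega> \<and> \<nu> n \<omega> = k \<and> S (Suc n) \<omega> - S n \<omega> = v} \<in> sets noise" for v
      proof -
        have [measurable]: "(\<lambda>\<omega>. S (Suc n) \<omega> - S n \<omega>) \<in> noise \<rightarrow>\<^sub>M count_space UNIV"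
          by (rule measurable_discrete2[OF S S])
        show ?thesis by measurable
      qed
      ultimately show ?thesis
        using V(1) by (simp only:, intro noise.P.finite_measure_finite_Union) (auto simp: disjoint_family_on_def)
    qed
    also have "\<dots> = \<P>(\<omega> in noise. has_past S \<nu> n s m \<omega>) / real n"
      using step[OF n k _ pos] sumK by (simp add: sum_distrib_left[symmetric] sum_divide_distrib[symmetric])
    finally have 1: "\<P>(\<omega> in noise. has_past S \<nu> n s m \<omega> \<and> \<nu> n \<omega> = k) = \<P>(\<omega> in noise. has_past S \<nu> n s m \<omega>) / real n" .
    then show "\<P>(\<omega> in noise. \<nu> n \<omega> = k \<bar> has_past S \<nu> n s m \<omega>) = 1 / real n"
      using pos by (simp add: cond_prob_def conj_commute)
    fix v assume v: "v \<in> V"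
    show "\<P>(\<omega> in noise. S (Suc n) \<omega> - S n \<omega> = v \<bar> has_past S \<nu> n s m \<omega> \<and> \<nu> n \<omega> = k) = K (s k - s (k - 1)) v"
      using 1 step[OF n k v pos] pos n by (simp add: cond_prob_def conj_ac)
  qed (rule \<nu>)
qed

section \<open>Axes and signs\<close>

text \<open>
  The uses of the noise: \<open>Axis n\<close> chooses the axis of the step from time \<open>n\<close> to \<open>n + 1\<close>, \<open>Sign i k\<close>
  the direction of the step along axis \<open>i\<close> that follows \<open>k\<close> earlier ones, and \<open>Recall n\<close> the recalled
  time.
\<close>

datatype 'd source = Axis nat | Sign 'd nat | Recall nat

instance source :: (countable) countable
  by countable_datatype

text \<open>
  Moves up with probability \<open>1/2 + h\<close>. The uniform number \<open>u\<close> is always compared with the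
  probability of moving away from the origin, which is \<open>1/2 - h\<close> for negative \<open>x\<close>: two walks that use the
  same \<open>u\<close> at the same distance from the origin then move outward monotonically in that probability,
  on whichever sides of the origin they are.
\<close>

definition turn :: "real \<Rightarrow> int \<Rightarrow> real \<Rightarrow> int"
  where "turn h x u =
    (if x < 0 then (if u < 1 / 2 - h then - 1 else 1) else (if u < 1 / 2 + h then 1 else - 1))"

lemma turn_pm: "turn h x u \<in> {1, - 1}"
  by (simp add: turn_def)

lemma measurable_turn [measurable]: "turn h x \<in> borel \<rightarrow>\<^sub>M count_space UNIV"
  unfolding turn_def[abs_def] by measurable

lemma measure_turn:
  assumes "\<bar>h\<bar> \<le> 1 / 2" "\<epsilon> \<in> {1, - 1}"
  shows "measure unif {u. turn h x u = \<epsilon>} = 1 / 2 + of_int \<epsilon> * h"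
proof -
  have *: "measure unif {u. u < t} = t" "measure unif {u. \<not> u < t} = 1 - t"
    if "0 \<le> t" "t \<le> 1" for t
  proof -
    show 1: "measure unif {u. u < t} = t"
      by (rule measure_unif_less[OF that])
    have "{u. u < t} \<in> sets borel"
      by simp
    then have "{u. u < t} \<in> sets unif"
      by (simp only: sets_unif)
    from prob_space.prob_compl[OF prob_space_unif this] show "measure unif {u. \<not> u < t} = 1 - t"
      unfolding 1 by (simp add: set_diff_eq)
  qed
  have "{u. turn h x u = \<epsilon>}
    = (if x < 0 then (if \<epsilon> = 1 then {u. \<not> u < 1 / 2 - h} else {u. u < 1 / 2 - h})
       else (if \<epsilon> = 1 then {u. u < 1 / 2 + h} else {u. \<not> u < 1 / 2 + h}))"
    using assms by (auto simp: turn_def)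
  with assms show ?thesis
    by (auto simp: * abs_le_iff simp del: not_less)
qed

text \<open>
  By parity, different absolute values differ by at least 2, and a unit step cannot reverse their
  order. At the origin every step leads to absolute value 1. In the remaining case both walks are at the
  same distance from the origin and decide by the same threshold rule; oddness of the biases covers
  opposite sides.
\<close>

lemma turn_outward_mono:
  fixes x y :: int
  assumes "\<bar>x\<bar> \<le> \<bar>y\<bar>" and "even (x + y)"
    and "h (- x) = - h x" "h' (- x) = - h' x"
    and "x \<noteq> 0 \<Longrightarrow> h \<bar>x\<bar> \<le> h' \<bar>x\<bar>"
  shows "\<bar>x + turn (h x) x u\<bar> \<le> \<bar>y + turn (h' y) y u\<bar>"
proof (cases "\<bar>x\<bar> = \<bar>y\<bar>")
  case False
  with assms(1,2) have "\<bar>x\<bar> + 2 \<le> \<bar>y\<bar>"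
    by presburger
  then show ?thesis
    using turn_pm[of "h x" x u] turn_pm[of "h' y" y u] by auto
next
  case True
  have pos: "h x \<le> h' x" if "x > 0"
    using assms(5) that by simp
  have neg: "h' x \<le> h x" if "x < 0"
    using assms(3-5) that by simp
  consider "x = 0" "y = 0" | "x \<noteq> 0" "y = x" | "x \<noteq> 0" "y = - x"
    using True by linarith
  then show ?thesis
  proof cases
    case 1
    then show ?thesis
      using turn_pm[of "h x" x u] turn_pm[of "h' y" y u] by auto
  next
    case 2
    then show ?thesis
      using pos neg unfolding 2(2) turn_def by (cases "x > 0") auto
  next
    case 3
    then show ?thesis
      using pos neg unfolding 3(2) assms(4) turn_def by (cases "x > 0") auto
  qed
qed

locale coupling =
  fixes i1 :: "'d::finite" and p :: real
  assumes p: "0 \<le> p" "p \<le> 1"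
begin

text \<open>
  With \<open>\<alpha>\<close> and \<open>\<gamma>\<close>, the MERW makes its next step along an axis that carries \<open>b\<close> of the first \<open>n\<close> steps
  with probability \<open>\<alpha> * b / n + \<gamma>\<close>. In terms of the kernel of the MERW, a step other than the recalled
  one has probability \<open>\<gamma> / 2\<close>, and the recalled one has \<open>\<alpha>\<close> more than that.
\<close>

definition \<alpha> :: real
  where "\<alpha> = (2 * real CARD('d) * p - 1) / (2 * real CARD('d) - 1)"

definition \<gamma> :: real
  where "\<gamma> = (2 - 2 * p) / (2 * real CARD('d) - 1)"

lemma card_ge_1: "real CARD('d) \<ge> 1"
  by (simp add: Suc_leI)

lemma card_pos: "2 * real CARD('d) - 1 > 0"
  using card_ge_1 by linarith

lemma \<gamma>_nonneg: "\<gamma> \<ge> 0"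
  unfolding \<gamma>_def using p card_pos by (intro divide_nonneg_pos) auto

lemma \<alpha>_plus_\<gamma>: "\<alpha> + \<gamma> = (2 * real CARD('d) * p - 2 * p + 1) / (2 * real CARD('d) - 1)"
  by (simp add: \<alpha>_def \<gamma>_def add_divide_distrib[symmetric])

lemma \<alpha>_plus_\<gamma>_pos: "\<alpha> + \<gamma> > 0"
proof -
  have "(2 * real CARD('d) - 2) * p \<ge> 0"
    using card_ge_1 p by (intro mult_nonneg_nonneg) auto
  then show ?thesis
    unfolding \<alpha>_plus_\<gamma> using card_pos by (intro divide_pos_pos) (auto simp: algebra_simps)
qed

lemma \<alpha>_plus_card_\<gamma>: "\<alpha> + real CARD('d) * \<gamma> = 1"
proof -
  have "(2 * real CARD('d) * p - 1) + real CARD('d) * (2 - 2 * p) = 2 * real CARD('d) - 1"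
    by (simp add: algebra_simps)
  then show ?thesis
    using card_pos by (simp add: \<alpha>_def \<gamma>_def add_divide_distrib[symmetric])
qed

lemma neg_2\<alpha>_le_\<gamma>: "- 2 * \<alpha> \<le> \<gamma>"
proof -
  have "p \<le> real CARD('d) * p"
    using card_ge_1 p by (simp add: mult_le_cancel_right1)
  then have "2 - 4 * (real CARD('d) * p) \<le> 2 - 2 * p"
    using p by linarith
  then have "- 2 * (2 * real CARD('d) * p - 1) \<le> 2 - 2 * p"
    by (simp add: algebra_simps)
  then show ?thesis
    using card_pos unfolding \<alpha>_def \<gamma>_def times_divide_eq_right by (intro divide_right_mono) auto
qed

text \<open>
  The bound that makes \<open>1/2\<close> plus or minus the bias of the MERW a probability; with \<open>x = b\<close> it also shows that
  axis probabilities are nonnegative. For negative \<open>\<alpha>\<close> it rests on \<open>neg_2\<alpha>_le_\<gamma>\<close>.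
\<close>

lemma abs_\<alpha>_le:
  fixes x b n :: real
  assumes "\<bar>x\<bar> \<le> b" "b \<le> n"
  shows "\<bar>\<alpha> * x\<bar> \<le> \<alpha> * b + \<gamma> * n"
proof -
  have "\<bar>\<alpha> * x\<bar> \<le> \<bar>\<alpha>\<bar> * b"
    using assms by (simp add: abs_mult mult_left_mono)
  also have "\<dots> \<le> (\<alpha> + \<gamma>) * b"
    using neg_2\<alpha>_le_\<gamma> \<gamma>_nonneg assms by (intro mult_right_mono) linarith+
  also have "\<dots> \<le> \<alpha> * b + \<gamma> * n"
    using assms \<gamma>_nonneg by (simp add: distrib_right mult_left_mono)
  finally show ?thesis .
qed

definition axis_weight :: "nat \<Rightarrow> ('d \<Rightarrow> nat) \<Rightarrow> 'd \<Rightarrow> real"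
  where "axis_weight n b i = \<alpha> * (real (b i) / real n) + \<gamma>"

lemma axis_weight_eq: "n \<ge> 1 \<Longrightarrow> axis_weight n b i = (\<alpha> * real (b i) + \<gamma> * real n) / real n"
  by (simp add: axis_weight_def field_simps)

definition axis_pmf :: "nat \<Rightarrow> ('d \<Rightarrow> nat) \<Rightarrow> 'd pmf"
  where "axis_pmf n b = embed_pmf (axis_weight n b)"

lemma pmf_axis_pmf:
  assumes "n \<ge> 1" "sum b UNIV = n"
  shows "pmf (axis_pmf n b) i = axis_weight n b i"
proof -
  have "pmf (embed_pmf (\<lambda>i. if i \<in> UNIV then axis_weight n b i else 0)) i
      = (if i \<in> UNIV then axis_weight n b i else 0)"
  proof (rule pmf_embed_pmf_finite)
    fix i
    have "b i \<le> n"
      unfolding assms(2)[symmetric] by (rule member_le_sum) auto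
    then have "\<bar>\<alpha> * real (b i)\<bar> \<le> \<alpha> * real (b i) + \<gamma> * real n"
      by (intro abs_\<alpha>_le) auto
    then show "axis_weight n b i \<ge> 0"
      using assms(1) by (simp add: axis_weight_eq)
    have "(\<Sum>i\<in>UNIV. axis_weight n b i) = \<alpha> * (real (sum b UNIV) / real n) + real CARD('d) * \<gamma>"
      by (simp add: axis_weight_def sum.distrib sum_distrib_left[symmetric] sum_divide_distrib[symmetric])
    then show "sum (axis_weight n b) UNIV = 1"
      using assms \<alpha>_plus_card_\<gamma> by simp
  qed simp
  then show ?thesis by (simp add: axis_pmf_def)
qed

abbreviation src :: "'d source \<Rightarrow> nat"
  where "src \<equiv> to_nat"

text \<open>
  The first step runs along axis \<open>i1\<close> without recourse to the noise.
\<close>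

definition next_axis :: "nat \<Rightarrow> ('d \<Rightarrow> nat) \<Rightarrow> real \<Rightarrow> 'd"
  where "next_axis n b u = (if n = 0 then i1 else quantile (axis_pmf n b) u)"

primrec counts :: "nat \<Rightarrow> (nat \<Rightarrow> real) \<Rightarrow> 'd \<Rightarrow> nat" where
  "counts 0 \<omega> = (\<lambda>_. 0)"
| "counts (Suc n) \<omega> = (let i = next_axis n (counts n \<omega>) (\<omega> (src (Axis n))) in
     (counts n \<omega>)(i := Suc (counts n \<omega> i)))"

definition axis_at :: "nat \<Rightarrow> (nat \<Rightarrow> real) \<Rightarrow> 'd"
  where "axis_at n \<omega> = next_axis n (counts n \<omega>) (\<omega> (src (Axis n)))"

text \<open>
  The exceptional value makes the very first step of every walk equal to \<open>axis i1 1\<close>. Axis \<open>i1\<close> has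
  been used zero times only at time 0, so no later step is affected.
\<close>

definition sign_at :: "'d \<Rightarrow> nat \<Rightarrow> real \<Rightarrow> int \<Rightarrow> (nat \<Rightarrow> real) \<Rightarrow> int"
  where "sign_at i k h x \<omega> = (if i = i1 \<and> k = 0 then 1 else turn h x (\<omega> (src (Sign i k))))"

section \<open>The walk with a given bias\<close>

text \<open>
  The bias is a function of the time, of the number of earlier steps along the chosen axis, and of
  the current coordinate along it. Walks with different biases share the axes and all uniform numbers.
\<close>

primrec walk :: "(nat \<Rightarrow> nat \<Rightarrow> int \<Rightarrow> real) \<Rightarrow> nat \<Rightarrow> (nat \<Rightarrow> real) \<Rightarrow> int ^ 'd" where
  "walk \<beta> 0 \<omega> = 0"
| "walk \<beta> (Suc n) \<omega> = walk \<beta> n \<omega> +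
    (let i = axis_at n \<omega>; k = counts n \<omega> i; x = walk \<beta> n \<omega> $ i
     in axis i (sign_at i k (\<beta> n k x) x \<omega>))"

lemma counts_Suc: "counts (Suc n) \<omega> = (counts n \<omega>)(axis_at n \<omega> := Suc (counts n \<omega> (axis_at n \<omega>)))"
  by (simp add: axis_at_def Let_def)

declare counts.simps(2) [simp del]

lemma sum_counts: "sum (counts n \<omega>) UNIV = n"
proof (induction n)
  case (Suc n)
  have "sum (counts (Suc n) \<omega>) UNIV = (\<Sum>i\<in>UNIV. counts n \<omega> i + (if i = axis_at n \<omega> then 1 else 0))"
    by (intro sum.cong) (auto simp: counts_Suc)
  then show ?case
    by (simp add: sum.distrib Suc)
qed simp

lemma counts_le: "counts n \<omega> i \<le> n"
  using member_le_sum[of i UNIV "counts n \<omega>"] by (simp add: sum_counts)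

lemma axis_at_0 [simp]: "axis_at 0 \<omega> = i1"
  by (simp add: axis_at_def next_axis_def)

lemma counts_first_pos: "n \<ge> 1 \<Longrightarrow> counts n \<omega> i1 > 0"
  by (induction n rule: dec_induct) (auto simp: counts_Suc)

lemma sign_at_pm: "sign_at i k h x \<omega> \<in> {1, - 1}"
  using turn_pm by (auto simp: sign_at_def)

lemma walk_Suc_nth: "walk \<beta> (Suc n) \<omega> $ i = walk \<beta> n \<omega> $ i +
    (if i = axis_at n \<omega>
     then sign_at i (counts n \<omega> i) (\<beta> n (counts n \<omega> i) (walk \<beta> n \<omega> $ i)) (walk \<beta> n \<omega> $ i) \<omega> else 0)"
  by (simp add: Let_def axis_def)

lemma walk_step: "\<exists>\<epsilon>\<in>{1, - 1}. walk \<beta> (Suc n) \<omega> - walk \<beta> n \<omega> = axis (axis_at n \<omega>) \<epsilon>"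
  using sign_at_pm by (simp only: walk.simps Let_def add_diff_cancel_left') blast

lemma axis_uminus: "- axis i (1::int) = axis i (- 1)"
  by (simp add: vec_eq_iff axis_def)

lemma axis_pm_in_dirs: "\<epsilon> \<in> {1, - 1} \<Longrightarrow> (axis i \<epsilon> :: int ^ 'd) \<in> axis_dirs j \<longleftrightarrow> i = j"
  by (auto simp: axis_dirs_def axis_uminus axis_eq_axis)

lemma walk_step_in_dirs: "walk \<beta> (Suc n) \<omega> - walk \<beta> n \<omega> \<in> axis_dirs i \<longleftrightarrow> axis_at n \<omega> = i"
  using walk_step[of \<beta> n \<omega>] axis_pm_in_dirs by auto

lemma walk_1: "walk \<beta> 1 \<omega> = axis i1 1"
  by (simp add: Let_def sign_at_def)

lemma abs_walk_le: "\<bar>walk \<beta> n \<omega> $ i\<bar> \<le> int (counts n \<omega> i)"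
proof (induction n)
  case (Suc n)
  then show ?case
    using sign_at_pm[of i "counts n \<omega> i" "\<beta> n (counts n \<omega> i) (walk \<beta> n \<omega> $ i)" "walk \<beta> n \<omega> $ i" \<omega>]
    unfolding walk_Suc_nth by (auto simp: counts_Suc)
qed simp

lemma even_walk_counts: "even (walk \<beta> n \<omega> $ i + int (counts n \<omega> i))"
proof (induction n)
  case (Suc n)
  then show ?case
    using sign_at_pm[of i "counts n \<omega> i" "\<beta> n (counts n \<omega> i) (walk \<beta> n \<omega> $ i)" "walk \<beta> n \<omega> $ i" \<omega>]
    unfolding walk_Suc_nth by (auto simp: counts_Suc)
qed simp

lemma axis_count_Suc: "axis_count s (Suc n) i = axis_count s n i + (if s (Suc n) - s n \<in> axis_dirs i then 1 else 0)"
proof -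
  have "{j \<in> {1..Suc n}. s j - s (j - 1) \<in> axis_dirs i}
    = {j \<in> {1..n}. s j - s (j - 1) \<in> axis_dirs i} \<union> (if s (Suc n) - s n \<in> axis_dirs i then {Suc n} else {})"
    by (auto simp: le_Suc_eq)
  then show ?thesis
    unfolding axis_count_def by (simp only:, subst card_Un_disjoint) auto
qed

lemma axis_count_walk: "axis_count (\<lambda>j. walk \<beta> j \<omega>) n = counts n \<omega>"
proof (induction n)
  case 0
  then show ?case by (simp add: axis_count_def fun_eq_iff)
next
  case (Suc n)
  then show ?case
    by (auto simp: axis_count_Suc counts_Suc walk_step_in_dirs fun_eq_iff simp del: walk.simps)
qed

lemma axis_count_cong: "(\<And>j. j \<le> n \<Longrightarrow> s j = t j) \<Longrightarrow> axis_count s n = axis_count t n"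
  unfolding axis_count_def by (intro ext arg_cong[where f = card]) auto

lemma measurable_next_axis [measurable]: "next_axis n b \<in> borel \<rightarrow>\<^sub>M count_space UNIV"
  unfolding next_axis_def[abs_def] by (cases "n = 0") simp_all

lemma measurable_counts [measurable]: "counts n \<in> noise \<rightarrow>\<^sub>M count_space UNIV"
proof (induction n)
  case (Suc n)
  define h where "h b i = b(i := Suc (b i))" for b :: "'d \<Rightarrow> nat" and i
  have "(\<lambda>\<omega>. h b (next_axis n b (\<omega> (src (Axis n))))) \<in> noise \<rightarrow>\<^sub>M count_space UNIV" for b
    by (rule measurable_compose[OF measurable_compose[OF measurable_noise_coord measurable_next_axis]]) simp
  then have "(\<lambda>\<omega>. h (counts n \<omega>) (next_axis n (counts n \<omega>) (\<omega> (src (Axis n))))) \<in> noise \<rightarrow>\<^sub>M count_space UNIV"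
    by (rule measurable_compose_countable[OF _ Suc])
  also have "(\<lambda>\<omega>. h (counts n \<omega>) (next_axis n (counts n \<omega>) (\<omega> (src (Axis n))))) = counts (Suc n)"
    by (simp add: fun_eq_iff h_def counts.simps(2) Let_def)
  finally show ?case .
qed simp

lemma measurable_axis_at [measurable]: "axis_at n \<in> noise \<rightarrow>\<^sub>M count_space UNIV"
  unfolding axis_at_def[abs_def]
  by (rule measurable_compose_countable[OF _ measurable_counts])
     (rule measurable_compose[OF measurable_noise_coord measurable_next_axis])

lemma measurable_sign_at [measurable]: "sign_at i k h x \<in> noise \<rightarrow>\<^sub>M count_space UNIV"
proof -
  have "(\<lambda>\<omega>. turn h x (\<omega> (src (Sign i k)))) \<in> noise \<rightarrow>\<^sub>M count_space UNIV"
    by (rule measurable_compose[OF measurable_noise_coord measurable_turn])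
  then show ?thesis
    unfolding sign_at_def[abs_def] by (cases "i = i1 \<and> k = 0") simp_all
qed

lemma measurable_walk [measurable]: "walk \<beta> n \<in> noise \<rightarrow>\<^sub>M count_space UNIV"
proof (induction n)
  case (Suc n)
  define h where "h y b i \<omega> = y + axis i (sign_at i (b i) (\<beta> n (b i) (y $ i)) (y $ i) \<omega>)"
    for y :: "int ^ 'd" and b :: "'d \<Rightarrow> nat" and i \<omega>
  have "h y b i \<in> noise \<rightarrow>\<^sub>M count_space UNIV" for y b i
    unfolding h_def[abs_def] by (rule measurable_compose[OF measurable_sign_at]) simp
  then have "(\<lambda>\<omega>. h y b (axis_at n \<omega>) \<omega>) \<in> noise \<rightarrow>\<^sub>M count_space UNIV" for y b
    by (rule measurable_compose_countable[OF _ measurable_axis_at])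
  then have "(\<lambda>\<omega>. h y (counts n \<omega>) (axis_at n \<omega>) \<omega>) \<in> noise \<rightarrow>\<^sub>M count_space UNIV" for y
    by (rule measurable_compose_countable[OF _ measurable_counts])
  then have "(\<lambda>\<omega>. h (walk \<beta> n \<omega>) (counts n \<omega>) (axis_at n \<omega>) \<omega>) \<in> noise \<rightarrow>\<^sub>M count_space UNIV"
    by (rule measurable_compose_countable[OF _ Suc])
  also have "(\<lambda>\<omega>. h (walk \<beta> n \<omega>) (counts n \<omega>) (axis_at n \<omega>) \<omega>) = walk \<beta> (Suc n)"
    by (simp add: fun_eq_iff h_def Let_def)
  finally show ?case .
qed simp

lemma counts_cong:
  assumes "\<And>m. m < n \<Longrightarrow> \<omega>' (src (Axis m)) = \<omega> (src (Axis m))"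
  shows "counts n \<omega>' = counts n \<omega>"
  using assms by (induction n) (simp_all add: counts.simps(2))

lemma counts_mono: "m \<le> n \<Longrightarrow> counts m \<omega> i \<le> counts n \<omega> i"
  by (induction n rule: dec_induct) (auto simp: counts_Suc)

text \<open>
  The signs read up to time \<open>n\<close> are exactly those with index below the counts at time \<open>n\<close>. The
  next sign along any axis is therefore still unused.
\<close>

lemma walk_cong:
  assumes "\<And>m. m < n \<Longrightarrow> \<omega>' (src (Axis m)) = \<omega> (src (Axis m))"
    and "\<And>i k. k < counts n \<omega> i \<Longrightarrow> \<omega>' (src (Sign i k)) = \<omega> (src (Sign i k))"
  shows "walk \<beta> n \<omega>' = walk \<beta> n \<omega>"
  using assms
proof (induction n)
  case (Suc n)
  have le: "counts n \<omega> i \<le> counts (Suc n) \<omega> i" for i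
    by (rule counts_mono) simp
  have walk: "walk \<beta> n \<omega>' = walk \<beta> n \<omega>"
    using Suc.prems less_le_trans[OF _ le] by (intro Suc.IH) (simp_all del: walk.simps)
  have counts: "counts n \<omega>' = counts n \<omega>"
    using Suc.prems(1) by (intro counts_cong) auto
  have axis: "axis_at n \<omega>' = axis_at n \<omega>"
    using Suc.prems(1) counts by (simp add: axis_at_def)
  have sign: "\<omega>' (src (Sign (axis_at n \<omega>) (counts n \<omega> (axis_at n \<omega>)))) = \<omega> (src (Sign (axis_at n \<omega>) (counts n \<omega> (axis_at n \<omega>))))"
    by (rule Suc.prems(2)) (simp add: counts_Suc)
  show ?case
    by (simp only: walk.simps Let_def walk counts axis sign_at_def sign)
qed simp

definition past_sources :: "nat \<Rightarrow> ('d \<Rightarrow> nat) \<Rightarrow> nat set"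
  where "past_sources n b = src ` (Axis ` {..<n} \<union> {Sign i k |i k. k < b i})"

lemma prob_sign_at:
  assumes "\<bar>h\<bar> \<le> 1 / 2" "\<epsilon> \<in> {1, - 1}" "\<not> (i = i1 \<and> k = 0)"
  shows "noise.P.prob {\<omega>. sign_at i k h x \<omega> = \<epsilon>} = 1 / 2 + of_int \<epsilon> * h"
  using measure_noise_coord[of "{u. turn h x u = \<epsilon>}" "src (Sign i k)"] measure_turn[OF assms(1,2), of x] assms(3)
  by (auto simp: sign_at_def)

text \<open>
  On an event that fixes the counts, the uniform numbers deciding the next axis and the next sign
  along that axis sit at fixed coordinates, and neither belongs to the past.
\<close>

lemma walk_step_law:
  assumes n: "n \<ge> 1" and E: "E \<in> sets noise" "depends_on (past_sources n b) E"
    and at: "\<And>\<omega>. \<omega> \<in> E \<Longrightarrow> counts n \<omega> = b \<and> walk \<beta> n \<omega> = y"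
    and b: "sum b UNIV = n" "b i1 > 0"
    and h: "\<bar>\<beta> n (b i) (y $ i)\<bar> \<le> 1 / 2" and \<epsilon>: "\<epsilon> \<in> {1, - 1}"
  shows "noise.P.prob (E \<inter> {\<omega>. walk \<beta> (Suc n) \<omega> - walk \<beta> n \<omega> = axis i \<epsilon>})
    = noise.P.prob E * (axis_weight n b i * (1 / 2 + of_int \<epsilon> * \<beta> n (b i) (y $ i)))"
proof -
  define A where "A = {\<omega>\<in>space noise. next_axis n b (\<omega> (src (Axis n))) = i}"
  define B where "B = {\<omega>\<in>space noise. sign_at i (b i) (\<beta> n (b i) (y $ i)) (y $ i) \<omega> = \<epsilon>}"
  have A: "A = {\<omega>. \<omega> (src (Axis n)) \<in> {u. quantile (axis_pmf n b) u = i}}"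
    using n by (auto simp: A_def next_axis_def)
  have [measurable]: "A \<in> sets noise"
    using n unfolding A_def next_axis_def by measurable
  have [measurable]: "B \<in> sets noise"
    unfolding B_def by measurable
  have dep: "depends_on {src (Axis n)} A" "depends_on {src (Sign i (b i))} B"
    by (auto simp: depends_on_def A_def B_def sign_at_def)
  have "walk \<beta> (Suc n) \<omega> - walk \<beta> n \<omega> = axis i \<epsilon> \<longleftrightarrow> \<omega> \<in> A \<inter> B" if "\<omega> \<in> E" for \<omega>
    using at[OF that] \<epsilon> by (auto simp: Let_def axis_at_def A_def B_def axis_eq_axis)
  then have "E \<inter> {\<omega>. walk \<beta> (Suc n) \<omega> - walk \<beta> n \<omega> = axis i \<epsilon>} = E \<inter> (A \<inter> B)"
    by blast
  also have "noise.P.prob (E \<inter> (A \<inter> B)) = noise.P.prob E * noise.P.prob (A \<inter> B)"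
    by (rule prob_indep[OF E _ depends_on_Int[OF dep]]) (auto simp: past_sources_def)
  also have "noise.P.prob (A \<inter> B) = noise.P.prob A * noise.P.prob B"
    by (rule prob_indep[OF _ dep(1) _ dep(2)]) auto
  also have "noise.P.prob A = axis_weight n b i"
    unfolding A using pmf_axis_pmf[OF n b(1), of i] measure_quantile[of "axis_pmf n b" i]
    by (subst measure_noise_coord) auto
  also have "noise.P.prob B = 1 / 2 + of_int \<epsilon> * \<beta> n (b i) (y $ i)"
    using prob_sign_at[OF h \<epsilon>] b(2) by (auto simp: B_def)
  finally show ?thesis .
qed

text \<open>
  The path determines the counts, so the event that the path has given values is of the kind
  considered in \<open>walk_step_law\<close>.
\<close>

lemma walk_path_law:
  assumes n: "n \<ge> 1" and \<epsilon>: "\<epsilon> \<in> {1, - 1}"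
    and h: "\<bar>\<beta> n (counts n \<omega>\<^sub>0 i) (walk \<beta> n \<omega>\<^sub>0 $ i)\<bar> \<le> 1 / 2"
  shows "\<P>(\<omega> in noise. (\<forall>j\<le>n. walk \<beta> j \<omega> = walk \<beta> j \<omega>\<^sub>0) \<and> walk \<beta> (Suc n) \<omega> - walk \<beta> n \<omega> = axis i \<epsilon>)
    = \<P>(\<omega> in noise. \<forall>j\<le>n. walk \<beta> j \<omega> = walk \<beta> j \<omega>\<^sub>0)
      * (axis_weight n (counts n \<omega>\<^sub>0) i * (1 / 2 + of_int \<epsilon> * \<beta> n (counts n \<omega>\<^sub>0 i) (walk \<beta> n \<omega>\<^sub>0 $ i)))"
proof -
  define E where "E = {\<omega>\<in>space noise. \<forall>j\<le>n. walk \<beta> j \<omega> = walk \<beta> j \<omega>\<^sub>0}"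
  have at: "counts n \<omega> = counts n \<omega>\<^sub>0" if "\<omega> \<in> E" for \<omega>
    using that axis_count_cong[of n "\<lambda>j. walk \<beta> j \<omega>" "\<lambda>j. walk \<beta> j \<omega>\<^sub>0"]
    by (simp add: E_def axis_count_walk)
  have law: "noise.P.prob (E \<inter> {\<omega>. walk \<beta> (Suc n) \<omega> - walk \<beta> n \<omega> = axis i \<epsilon>})
    = noise.P.prob E * (axis_weight n (counts n \<omega>\<^sub>0) i * (1 / 2 + of_int \<epsilon> * \<beta> n (counts n \<omega>\<^sub>0 i) (walk \<beta> n \<omega>\<^sub>0 $ i)))"
  proof (rule walk_step_law[where \<beta> = \<beta>, OF n _ _ _ sum_counts counts_first_pos[OF n] h \<epsilon>])
    show "E \<in> sets noise"
      unfolding E_def by measurable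
    show "depends_on (past_sources n (counts n \<omega>\<^sub>0)) E"
    proof (rule depends_onI)
      fix \<omega> \<omega>' assume \<omega>: "\<omega> \<in> E"
        and agree: "\<And>j. j \<in> past_sources n (counts n \<omega>\<^sub>0) \<Longrightarrow> \<omega>' j = \<omega> j"
      have "walk \<beta> m \<omega>' = walk \<beta> m \<omega>" if "m \<le> n" for m
      proof (rule walk_cong)
        show "\<omega>' (src (Axis j)) = \<omega> (src (Axis j))" if "j < m" for j
          using that \<open>m \<le> n\<close> by (intro agree) (auto simp: past_sources_def)
        show "\<omega>' (src (Sign i k)) = \<omega> (src (Sign i k))" if "k < counts m \<omega> i" for i k
        proof -
          have "k < counts n \<omega>\<^sub>0 i"
            using that counts_mono[OF \<open>m \<le> n\<close>, of \<omega> i] at[OF \<omega>] by simp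
          then show ?thesis by (intro agree) (auto simp: past_sources_def)
        qed
      qed
      with \<omega> show "\<omega>' \<in> E" by (simp add: E_def)
    qed
    show "counts n \<omega> = counts n \<omega>\<^sub>0 \<and> walk \<beta> n \<omega> = walk \<beta> n \<omega>\<^sub>0" if "\<omega> \<in> E" for \<omega>
      using at[OF that] that by (simp add: E_def)
  qed
  have event: "E \<inter> {\<omega>. walk \<beta> (Suc n) \<omega> - walk \<beta> n \<omega> = axis i \<epsilon>}
    = {\<omega>\<in>space noise. (\<forall>j\<le>n. walk \<beta> j \<omega> = walk \<beta> j \<omega>\<^sub>0) \<and> walk \<beta> (Suc n) \<omega> - walk \<beta> n \<omega> = axis i \<epsilon>}"
    unfolding E_def by blast
  show ?thesis
    using law unfolding event unfolding E_def .
qed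

section \<open>Elephant random walks in several dimensions\<close>

lemma unit_steps_eq: "(unit_steps :: (int ^ 'd) set) = (\<lambda>(i, \<epsilon>). axis i \<epsilon>) ` (UNIV \<times> {1, - 1})"
  unfolding unit_steps_def axis_dirs_def axis_uminus by force

lemma finite_unit_steps: "finite (unit_steps :: (int ^ 'd) set)"
  unfolding unit_steps_eq by simp

lemma card_unit_steps: "card (unit_steps :: (int ^ 'd) set) = 2 * CARD('d)"
proof -
  have "inj_on (\<lambda>(i :: 'd, \<epsilon> :: int). axis i \<epsilon>) (UNIV \<times> {1, - 1})"
    by (auto simp: inj_on_def axis_eq_axis)
  then show ?thesis
    unfolding unit_steps_eq by (simp add: card_image card_cartesian_product)
qed

lemma walk_step_unit: "walk \<beta> (Suc n) \<omega> - walk \<beta> n \<omega> \<in> unit_steps"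
proof -
  obtain \<epsilon> where "\<epsilon> \<in> {1, - 1}" "walk \<beta> (Suc n) \<omega> - walk \<beta> n \<omega> = axis (axis_at n \<omega>) \<epsilon>"
    using walk_step by blast
  then show ?thesis
    unfolding unit_steps_eq by (intro image_eqI[of _ _ "(axis_at n \<omega>, \<epsilon>)"]) simp_all
qed

lemma nearest_neighbour_walk: "nearest_neighbour noise (walk \<beta>)"
  unfolding nearest_neighbour_def using walk_step_unit by blast

text \<open>
  Division by zero makes this bias vanish when \<open>k = 0\<close>, as the definition of the \<open>d\<close>-ERW
  demands.
\<close>

definition erw_bias :: "real \<Rightarrow> nat \<Rightarrow> nat \<Rightarrow> int \<Rightarrow> real"
  where "erw_bias q n k x = (2 * q - 1) * of_int x / (2 * real k)"

text \<open>
  Averaging the kernel of the MERW over the recalled time gives the step \<open>\<epsilon>\<close> along an axis the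
  probability \<open>(\<alpha> * k + \<gamma> * n + \<epsilon> * \<alpha> * x) / (2 * n)\<close>. Divided by the probability \<open>(\<alpha> * k + \<gamma> * n) / n\<close> of the axis, this is \<open>1/2\<close> plus
  \<open>\<epsilon>\<close> times the following bias.
\<close>

definition merw_bias :: "nat \<Rightarrow> nat \<Rightarrow> int \<Rightarrow> real"
  where "merw_bias n k x = \<alpha> * of_int x / (2 * (\<alpha> * real k + \<gamma> * real n))"

lemma abs_erw_bias_le:
  assumes "q \<in> {0..1}" "\<bar>x\<bar> \<le> int k"
  shows "\<bar>erw_bias q n k x\<bar> \<le> 1 / 2"
proof (cases "k = 0")
  case False
  have "\<bar>of_int x :: real\<bar> \<le> real k"
    using assms(2) by linarith
  moreover have "\<bar>2 * q - 1\<bar> \<le> 1"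
    using assms(1) by auto
  ultimately have "\<bar>2 * q - 1\<bar> * \<bar>of_int x :: real\<bar> \<le> 1 * real k"
    by (intro mult_mono) auto
  then have "\<bar>(2 * q - 1) * of_int x\<bar> \<le> real k"
    by (simp add: abs_mult)
  then show ?thesis
    using False unfolding erw_bias_def abs_divide by (simp add: divide_le_eq)
qed (simp add: erw_bias_def)

lemma abs_merw_bias_le:
  assumes "\<bar>x\<bar> \<le> int k" "k \<le> n"
  shows "\<bar>merw_bias n k x\<bar> \<le> 1 / 2"
proof -
  have "\<bar>of_int x :: real\<bar> \<le> real k"
    using assms(1) by linarith
  then have "\<bar>\<alpha> * of_int x\<bar> \<le> \<alpha> * real k + \<gamma> * real n"
    using assms(2) by (intro abs_\<alpha>_le) auto
  then show ?thesis
    unfolding merw_bias_def by (cases "\<alpha> * real k + \<gamma> * real n = 0") (auto simp: abs_mult field_simps)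
qed

lemma d_erw_walk:
  assumes q: "q \<in> {0..1}"
  shows "d_erw noise i1 p q (walk (erw_bias q))"
proof -
  have step: "cond_prob noise (\<lambda>\<omega>. walk (erw_bias q) (Suc n) \<omega> - walk (erw_bias q) n \<omega> = axis i \<epsilon>)
      (\<lambda>\<omega>. \<forall>j\<le>n. walk (erw_bias q) j \<omega> = s j)
    = axis_prob p s n i * (1 / 2 + of_int \<epsilon> * sign_bias q s n i)"
    if n: "n \<ge> 1" and \<epsilon>: "\<epsilon> \<in> {1, - 1}" and pos: "\<P>(\<omega> in noise. \<forall>j\<le>n. walk (erw_bias q) j \<omega> = s j) > 0"
    for n i \<epsilon> s
  proof -
    obtain \<omega>\<^sub>0 where \<omega>\<^sub>0: "\<forall>j\<le>n. walk (erw_bias q) j \<omega>\<^sub>0 = s j"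
      using pos by (metis (mono_tags, lifting) Collect_empty_eq measure_empty less_irrefl)
    then have past: "(\<forall>j\<le>n. walk (erw_bias q) j \<omega> = s j) \<longleftrightarrow> (\<forall>j\<le>n. walk (erw_bias q) j \<omega> = walk (erw_bias q) j \<omega>\<^sub>0)" for \<omega>
      by simp
    have count: "axis_count s n = counts n \<omega>\<^sub>0"
      using axis_count_cong[of n s "\<lambda>j. walk (erw_bias q) j \<omega>\<^sub>0"] \<omega>\<^sub>0 by (simp add: axis_count_walk)
    have "axis_prob p s n i = axis_weight n (counts n \<omega>\<^sub>0) i"
      by (simp add: axis_prob_def axis_weight_def \<alpha>_def \<gamma>_def count)
    moreover have "sign_bias q s n i = erw_bias q n (counts n \<omega>\<^sub>0 i) (walk (erw_bias q) n \<omega>\<^sub>0 $ i)"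
      using \<omega>\<^sub>0 by (simp add: sign_bias_def erw_bias_def count)
    moreover note walk_path_law[where \<beta> = "erw_bias q" and \<omega>\<^sub>0 = \<omega>\<^sub>0, OF n \<epsilon> abs_erw_bias_le[OF q abs_walk_le], of i]
    ultimately show ?thesis
      using pos unfolding cond_prob_def past by (simp add: conj_commute del: walk.simps)
  qed
  show ?thesis
    unfolding d_erw_def
  proof (intro conjI ballI allI impI measurable_walk nearest_neighbour_walk)
    fix n i and s :: "nat \<Rightarrow> int ^ 'd"
    assume n: "1 \<le> n" and pos: "\<P>(\<omega> in noise. \<forall>j\<le>n. walk (erw_bias q) j \<omega> = s j) > 0"
    show "cond_prob noise (\<lambda>\<omega>. walk (erw_bias q) (Suc n) \<omega> - walk (erw_bias q) n \<omega> = axis i 1)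
      (\<lambda>\<omega>. \<forall>j\<le>n. walk (erw_bias q) j \<omega> = s j) = axis_prob p s n i * (1 / 2 + sign_bias q s n i)"
      using step[OF n _ pos, of 1 i] by (simp del: walk.simps)
    show "cond_prob noise (\<lambda>\<omega>. walk (erw_bias q) (Suc n) \<omega> - walk (erw_bias q) n \<omega> = - axis i 1)
      (\<lambda>\<omega>. \<forall>j\<le>n. walk (erw_bias q) j \<omega> = s j) = axis_prob p s n i * (1 / 2 - sign_bias q s n i)"
      using step[OF n _ pos, of "- 1" i] by (simp add: axis_uminus del: walk.simps)
  qed (use walk_1 in simp_all)
qed

text \<open>
  Steps in one direction are counted by half the sum of the number of steps along the axis and the
  signed displacement.
\<close>

lemma count_directed_steps:
  assumes "\<epsilon> \<in> {1, - 1}"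
  shows "(\<Sum>k=1..n. if axis i \<epsilon> = walk \<beta> k \<omega> - walk \<beta> (k - 1) \<omega> then 1 else 0 :: real)
    = (real (counts n \<omega> i) + of_int (\<epsilon> * walk \<beta> n \<omega> $ i)) / 2"
proof (induction n)
  case (Suc n)
  obtain \<delta> where \<delta>: "\<delta> \<in> {1, - 1}" and step: "walk \<beta> (Suc n) \<omega> - walk \<beta> n \<omega> = axis (axis_at n \<omega>) \<delta>"
    using walk_step by blast
  then have walk: "walk \<beta> (Suc n) \<omega> = walk \<beta> n \<omega> + axis (axis_at n \<omega>) \<delta>"
    by (simp add: algebra_simps)
  have "(\<Sum>k=1..Suc n. if axis i \<epsilon> = walk \<beta> k \<omega> - walk \<beta> (k - 1) \<omega> then 1 else 0 :: real)
    = (\<Sum>k=1..n. if axis i \<epsilon> = walk \<beta> k \<omega> - walk \<beta> (k - 1) \<omega> then 1 else 0)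
      + (if axis i \<epsilon> = walk \<beta> (Suc n) \<omega> - walk \<beta> n \<omega> then 1 else 0)"
    by (simp del: walk.simps)
  also have "\<dots> = (real (counts n \<omega> i) + of_int (\<epsilon> * walk \<beta> n \<omega> $ i)) / 2
      + (if axis i \<epsilon> = axis (axis_at n \<omega>) \<delta> then 1 else 0)"
    unfolding Suc.IH step ..
  also have "\<dots> = (real (counts (Suc n) \<omega> i) + of_int (\<epsilon> * walk \<beta> (Suc n) \<omega> $ i)) / 2"
  proof -
    have "axis i \<epsilon> = axis (axis_at n \<omega>) \<delta> \<longleftrightarrow> i = axis_at n \<omega> \<and> \<epsilon> = \<delta>"
      using assms \<delta> by (auto simp: axis_eq_axis)
    then have directed: "(if axis i \<epsilon> = axis (axis_at n \<omega>) \<delta> then 1 else 0 :: real)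
        = (if i = axis_at n \<omega> then (if \<epsilon> = \<delta> then 1 else 0) else 0)"
      by simp
    have sign: "(if \<epsilon> = \<delta> then 1 else 0 :: real) = (1 + of_int (\<epsilon> * \<delta>)) / 2"
      using \<delta> assms by auto
    have count: "real (counts (Suc n) \<omega> i) = real (counts n \<omega> i) + (if i = axis_at n \<omega> then 1 else 0)"
      by (simp add: counts_Suc)
    have position: "real_of_int (\<epsilon> * walk \<beta> (Suc n) \<omega> $ i)
        = of_int (\<epsilon> * walk \<beta> n \<omega> $ i) + (if i = axis_at n \<omega> then of_int (\<epsilon> * \<delta>) else 0)"
      unfolding walk by (simp add: axis_def distrib_left)
    show ?thesis
      unfolding directed sign count position by (simp add: add_divide_distrib)
  qed
  finally show ?case .
qed simp

lemma avoids_recall: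
  assumes "\<And>j. j \<in> - range (\<lambda>n. src (Recall n)) \<Longrightarrow> \<omega>' j = \<omega> j"
  shows "\<omega>' (src (Axis n)) = \<omega> (src (Axis n))" "\<omega>' (src (Sign i k)) = \<omega> (src (Sign i k))"
  by (auto intro!: assms)

lemma inj_recall: "inj (\<lambda>n. src (Recall n))"
  by (auto simp: inj_on_def)

lemma merw_kernel: "(if v = \<tau> then p else (1 - p) / (2 * real CARD('d) - 1)) = \<gamma> / 2 + \<alpha> * (if v = \<tau> then 1 else 0)"
proof -
  have half: "1 - p = (2 - 2 * p) / 2"
    by simp
  have \<gamma>: "\<gamma> / 2 = (1 - p) / (2 * real CARD('d) - 1)"
    unfolding \<gamma>_def half by (simp only: divide_divide_eq_left mult.commute)
  have "\<gamma> / 2 + \<alpha> = (1 - p + (2 * real CARD('d) * p - 1)) / (2 * real CARD('d) - 1)"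
    unfolding \<gamma> \<alpha>_def add_divide_distrib ..
  also have "1 - p + (2 * real CARD('d) * p - 1) = p * (2 * real CARD('d) - 1)"
    by (simp add: algebra_simps)
  finally have "\<gamma> / 2 + \<alpha> = p"
    using card_pos by simp
  then show ?thesis
    unfolding \<gamma>[symmetric] by simp
qed

text \<open>
  By \<open>memory_walkI\<close>, only the mean of the kernel over the recalled times has to be compared with
  \<open>walk_path_law\<close>. By \<open>count_directed_steps\<close>, that mean depends only on the axis count and the
  coordinate.
\<close>

lemma merw_walk: "merw noise i1 p (walk merw_bias)"
  unfolding merw_def
proof (intro conjI allI ballI measurable_walk)
  show "memory_walk noise unit_steps (\<lambda>\<tau> v. if v = \<tau> then p else (1 - p) / (2 * real CARD('d) - 1)) (walk merw_bias)"
  proof (rule memory_walkI[where S = "walk merw_bias", OF inj_recall _ measurable_walk _ finite_unit_steps walk_step_unit])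
    show "- range (\<lambda>n. src (Recall n)) \<inter> range (\<lambda>n. src (Recall n)) = {}"
      by simp
    show "walk merw_bias n \<omega>' = walk merw_bias n \<omega>"
      if "\<And>j. j \<in> - range (\<lambda>n. src (Recall n)) \<Longrightarrow> \<omega>' j = \<omega> j" for n \<omega> \<omega>'
      by (rule walk_cong) (rule avoids_recall[OF that], assumption)+
    show "(if v = \<tau> then p else (1 - p) / (2 * real CARD('d) - 1)) \<ge> 0" for v \<tau> :: "int ^ 'd"
      using p card_pos by simp
    show "(\<Sum>v\<in>unit_steps. if v = \<tau> then p else (1 - p) / (2 * real CARD('d) - 1)) = 1"
      if "\<tau> \<in> unit_steps" for \<tau> :: "int ^ 'd"
      unfolding merw_kernel using that finite_unit_steps \<alpha>_plus_card_\<gamma>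
      by (simp add: sum.distrib sum_distrib_left[symmetric] card_unit_steps)
    fix n :: nat and v and \<omega>\<^sub>0
    assume n: "n \<ge> 1" and "v \<in> (unit_steps :: (int ^ 'd) set)"
    then obtain i \<epsilon> where v: "v = axis i \<epsilon>" and \<epsilon>: "\<epsilon> \<in> {1, - 1}"
      unfolding unit_steps_eq by auto
    define b where "b = counts n \<omega>\<^sub>0 i"
    define x where "x = walk merw_bias n \<omega>\<^sub>0 $ i"
    define W where "W = \<alpha> * real b + \<gamma> * real n"
    have b: "b \<le> n" and x: "\<bar>x\<bar> \<le> int b"
      by (simp_all add: b_def x_def counts_le abs_walk_le)
    have "\<bar>of_int x :: real\<bar> \<le> real b"
      using x by linarith
    then have W: "\<bar>\<alpha> * of_int x\<bar> \<le> W"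
      unfolding W_def using b by (intro abs_\<alpha>_le) auto
    have "(\<Sum>k=1..n. if v = walk merw_bias k \<omega>\<^sub>0 - walk merw_bias (k - 1) \<omega>\<^sub>0 then p else (1 - p) / (2 * real CARD('d) - 1)) / real n
      = (real n * (\<gamma> / 2) + \<alpha> * ((real b + of_int (\<epsilon> * x)) / 2)) / real n"
      unfolding merw_kernel v sum.distrib sum_distrib_left[symmetric] count_directed_steps[OF \<epsilon>] b_def x_def by simp
    also have "\<dots> = (W + of_int \<epsilon> * (\<alpha> * of_int x)) / (2 * real n)"
      using n by (simp add: W_def field_simps)
    \<comment> \<open>If \<open>W = 0\<close>, the axis has probability zero; the bound on \<open>\<alpha> * x\<close> then makes the left side vanish too.\<close>
    also have "\<dots> = W / real n * (1 / 2 + of_int \<epsilon> * (\<alpha> * of_int x / (2 * W)))"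
      using W n by (cases "W = 0") (simp_all add: field_simps)
    also have "\<dots> = axis_weight n (counts n \<omega>\<^sub>0) i * (1 / 2 + of_int \<epsilon> * merw_bias n b x)"
      unfolding merw_bias_def W_def[symmetric] axis_weight_eq[OF n] b_def[symmetric] ..
    finally show "\<P>(\<omega> in noise. (\<forall>j\<le>n. walk merw_bias j \<omega> = walk merw_bias j \<omega>\<^sub>0) \<and> walk merw_bias (Suc n) \<omega> - walk merw_bias n \<omega> = v)
      = \<P>(\<omega> in noise. \<forall>j\<le>n. walk merw_bias j \<omega> = walk merw_bias j \<omega>\<^sub>0)
        * ((\<Sum>k=1..n. if v = walk merw_bias k \<omega>\<^sub>0 - walk merw_bias (k - 1) \<omega>\<^sub>0 then p else (1 - p) / (2 * real CARD('d) - 1)) / real n)"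
      using walk_path_law[where \<beta> = merw_bias and \<omega>\<^sub>0 = \<omega>\<^sub>0, OF n \<epsilon> abs_merw_bias_le[OF abs_walk_le counts_le], of i]
      unfolding v b_def x_def by (simp only:)
  qed
qed (use walk_1 in simp_all)

section \<open>The elephants inside a walk\<close>

text \<open>
  The one-dimensional walk that consumes the signs of axis \<open>i\<close> in order. Its own time is the number
  of earlier steps along the axis, and with the position this is all that the bias of a \<open>d\<close>-ERW is made of.
\<close>

primrec elephant :: "real \<Rightarrow> 'd \<Rightarrow> nat \<Rightarrow> (nat \<Rightarrow> real) \<Rightarrow> int" where
  "elephant q i 0 \<omega> = 0"
| "elephant q i (Suc k) \<omega> = elephant q i k \<omega> +
    sign_at i k (erw_bias q 0 k (elephant q i k \<omega>)) (elephant q i k \<omega>) \<omega>"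

text \<open>
  Both sides use the same uniform number for the same step, because signs are indexed by the
  number of earlier steps along the axis. For a bias that depends on time, like that of the MERW, there is no such
  identity.
\<close>

lemma walk_erw_nth: "walk (erw_bias q) n \<omega> $ i = elephant q i (counts n \<omega> i) \<omega>"
proof (induction n)
  case (Suc n)
  then show ?case
    unfolding walk_Suc_nth Suc.IH by (simp add: counts_Suc erw_bias_def)
qed simp

lemma elephant_step: "elephant q i (Suc k) \<omega> - elephant q i k \<omega> \<in> {1, - 1}"
  using sign_at_pm by simp

lemma abs_elephant_le: "\<bar>elephant q i k \<omega>\<bar> \<le> int k"
proof (induction k)
  case (Suc k)
  then show ?case
    using elephant_step[of q i k \<omega>] by (auto simp del: elephant.simps)
qed simp

lemma measurable_elephant [measurable]: "elephant q i k \<in> noise \<rightarrow>\<^sub>M count_space UNIV"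
proof (induction k)
  case (Suc k)
  define h where "h x \<omega> = x + sign_at i k (erw_bias q 0 k x) x \<omega>" for x \<omega>
  have "h x \<in> noise \<rightarrow>\<^sub>M count_space UNIV" for x
    unfolding h_def[abs_def] by (rule measurable_compose[OF measurable_sign_at]) simp
  then have "(\<lambda>\<omega>. h (elephant q i k \<omega>) \<omega>) \<in> noise \<rightarrow>\<^sub>M count_space UNIV"
    by (rule measurable_compose_countable[OF _ Suc])
  also have "(\<lambda>\<omega>. h (elephant q i k \<omega>) \<omega>) = elephant q i (Suc k)"
    by (simp add: fun_eq_iff h_def)
  finally show ?case .
qed simp

lemma elephant_cong:
  assumes "\<And>j. j < k \<Longrightarrow> \<omega>' (src (Sign i j)) = \<omega> (src (Sign i j))"
  shows "elephant q i k \<omega>' = elephant q i k \<omega>"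
  using assms by (induction k) (simp_all add: sign_at_def)

lemma elephant_path_law:
  assumes q: "q \<in> {0..1}" and k: "k \<ge> 1" and v: "v \<in> {1, - 1}"
  shows "\<P>(\<omega> in noise. (\<forall>j\<le>k. elephant q i j \<omega> = elephant q i j \<omega>\<^sub>0) \<and> elephant q i (Suc k) \<omega> - elephant q i k \<omega> = v)
    = \<P>(\<omega> in noise. \<forall>j\<le>k. elephant q i j \<omega> = elephant q i j \<omega>\<^sub>0)
      * (1 / 2 + of_int v * erw_bias q 0 k (elephant q i k \<omega>\<^sub>0))"
proof -
  define x where "x = elephant q i k \<omega>\<^sub>0"
  define E where "E = {\<omega>\<in>space noise. \<forall>j\<le>k. elephant q i j \<omega> = elephant q i j \<omega>\<^sub>0}"
  define B where "B = {\<omega>\<in>space noise. sign_at i k (erw_bias q 0 k x) x \<omega> = v}"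
  have event: "{\<omega>\<in>space noise. (\<forall>j\<le>k. elephant q i j \<omega> = elephant q i j \<omega>\<^sub>0) \<and> elephant q i (Suc k) \<omega> - elephant q i k \<omega> = v} = E \<inter> B"
    by (auto simp: E_def B_def x_def)
  have "noise.P.prob (E \<inter> B) = noise.P.prob E * noise.P.prob B"
  proof (rule prob_indep)
    show "E \<in> sets noise" "B \<in> sets noise"
      unfolding E_def B_def by measurable
    show "depends_on {src (Sign i k)} B"
      by (auto simp: depends_on_def B_def sign_at_def)
    show "depends_on ((\<lambda>j. src (Sign i j)) ` {..<k}) E"
    proof (rule depends_onI)
      fix \<omega> \<omega>' assume \<omega>: "\<omega> \<in> E" and agree: "\<And>j. j \<in> (\<lambda>j. src (Sign i j)) ` {..<k} \<Longrightarrow> \<omega>' j = \<omega> j"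
      have "elephant q i j \<omega>' = elephant q i j \<omega>" if "j \<le> k" for j
        using that by (intro elephant_cong agree) auto
      with \<omega> show "\<omega>' \<in> E" by (simp add: E_def)
    qed
  qed auto
  also have "noise.P.prob B = 1 / 2 + of_int v * erw_bias q 0 k x"
    using prob_sign_at[where h = "erw_bias q 0 k x" and \<epsilon> = v and i = i and k = k and x = x] abs_erw_bias_le[OF q abs_elephant_le[of q i k \<omega>\<^sub>0], of 0] v k
    by (simp add: B_def x_def)
  finally show ?thesis
    unfolding event unfolding E_def x_def .
qed

lemma count_elephant_steps:
  assumes "v \<in> {1, - 1}"
  shows "(\<Sum>k=1..n. if v = elephant q i k \<omega> - elephant q i (k - 1) \<omega> then 1 else 0 :: real)
    = (real n + of_int (v * elephant q i n \<omega>)) / 2"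
proof (induction n)
  case (Suc n)
  have "(\<Sum>k=1..Suc n. if v = elephant q i k \<omega> - elephant q i (k - 1) \<omega> then 1 else 0 :: real)
    = (\<Sum>k=1..n. if v = elephant q i k \<omega> - elephant q i (k - 1) \<omega> then 1 else 0)
      + (if v = elephant q i (Suc n) \<omega> - elephant q i n \<omega> then 1 else 0)"
    by (simp del: elephant.simps)
  also have "\<dots> = (real n + of_int (v * elephant q i n \<omega>)) / 2
      + (if v = elephant q i (Suc n) \<omega> - elephant q i n \<omega> then 1 else 0)"
    unfolding Suc.IH ..
  also have "\<dots> = (real (Suc n) + of_int (v * elephant q i (Suc n) \<omega>)) / 2"
  proof -
    obtain \<delta> where \<delta>: "\<delta> \<in> {1, - 1}" and "elephant q i (Suc n) \<omega> - elephant q i n \<omega> = \<delta>"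
      using elephant_step by blast
    then have step: "elephant q i (Suc n) \<omega> = elephant q i n \<omega> + \<delta>"
      by linarith
    show ?thesis
      unfolding step using \<delta> assms by (auto simp: field_simps)
  qed
  finally show ?case .
qed simp

lemma erw_elephant:
  assumes q: "q \<in> {0..1}"
  shows "erw noise q (elephant q i)"
  unfolding erw_def
proof (intro conjI allI ballI measurable_elephant)
  show "memory_walk noise {1, - 1} (\<lambda>\<tau> v. if v = \<tau> then q else 1 - q) (elephant q i)"
  proof (rule memory_walkI[where S = "elephant q i", OF inj_recall _ measurable_elephant _ _ elephant_step])
    show "- range (\<lambda>n. src (Recall n)) \<inter> range (\<lambda>n. src (Recall n)) = {}"
      by simp
    show "elephant q i n \<omega>' = elephant q i n \<omega>"
      if "\<And>j. j \<in> - range (\<lambda>n. src (Recall n)) \<Longrightarrow> \<omega>' j = \<omega> j" for n \<omega> \<omega>'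
      by (rule elephant_cong) (rule avoids_recall[OF that], assumption)
    show "(if v = \<tau> then q else 1 - q) \<ge> 0" for v \<tau> :: int
      using q by simp
    show "(\<Sum>v\<in>{1, - 1}. if v = \<tau> then q else 1 - q) = 1" if "\<tau> \<in> {1, - 1}" for \<tau> :: int
      using that by auto
    fix n :: nat and v and \<omega>\<^sub>0
    assume n: "n \<ge> 1" and v: "v \<in> {1, - 1 :: int}"
    define x where "x = elephant q i n \<omega>\<^sub>0"
    have kernel: "(if v = \<tau> then q else 1 - q) = (1 - q) + (2 * q - 1) * (if v = \<tau> then 1 else 0)" for \<tau>
      by simp
    have "(\<Sum>k=1..n. if v = elephant q i k \<omega>\<^sub>0 - elephant q i (k - 1) \<omega>\<^sub>0 then q else 1 - q) / real n
      = (real n * (1 - q) + (2 * q - 1) * ((real n + of_int (v * x)) / 2)) / real n"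
      unfolding kernel sum.distrib sum_distrib_left[symmetric] count_elephant_steps[OF v] x_def by simp
    also have "\<dots> = 1 / 2 + of_int v * erw_bias q 0 n x"
      using n by (simp add: erw_bias_def field_simps)
    finally show "\<P>(\<omega> in noise. (\<forall>j\<le>n. elephant q i j \<omega> = elephant q i j \<omega>\<^sub>0) \<and> elephant q i (Suc n) \<omega> - elephant q i n \<omega> = v)
      = \<P>(\<omega> in noise. \<forall>j\<le>n. elephant q i j \<omega> = elephant q i j \<omega>\<^sub>0)
        * ((\<Sum>k=1..n. if v = elephant q i k \<omega>\<^sub>0 - elephant q i (k - 1) \<omega>\<^sub>0 then q else 1 - q) / real n)"
      using elephant_path_law[OF q n v, of i \<omega>\<^sub>0] unfolding x_def by (simp only:)
  qed simp
  show "elephant q i 1 \<omega> \<in> {1, - 1}" for \<omega>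
    using sign_at_pm by simp
qed simp

lemma indep_vars_elephants:
  "noise.P.indep_vars (\<lambda>i. Pi\<^sub>M UNIV (\<lambda>n::nat. count_space UNIV)) (\<lambda>i \<omega> n. elephant q i n \<omega>) UNIV"
proof -
  define J where "J i = range (\<lambda>k. src (Sign i k))" for i
  have "noise.P.indep_vars (\<lambda>i. Pi\<^sub>M (J i) (\<lambda>_. unif)) (\<lambda>i \<omega>. restrict (\<lambda>j. \<omega> j) (J i)) UNIV"
    by (rule noise.P.indep_vars_restrict[OF indep_vars_noise]) (auto simp: J_def disjoint_family_on_def)
  then have "noise.P.indep_vars (\<lambda>i. Pi\<^sub>M UNIV (\<lambda>n::nat. count_space UNIV))
      (\<lambda>i \<omega>. (\<lambda>\<omega> n. elephant q i n (extend0 (J i) \<omega>)) (restrict (\<lambda>j. \<omega> j) (J i))) UNIV"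
  proof (rule noise.P.indep_vars_compose2)
    fix i
    have "(\<lambda>\<omega> n. elephant q i n \<omega>) \<in> noise \<rightarrow>\<^sub>M Pi\<^sub>M UNIV (\<lambda>n::nat. count_space UNIV)"
      by (rule measurable_PiM_single') auto
    then show "(\<lambda>\<omega> n. elephant q i n (extend0 (J i) \<omega>)) \<in> Pi\<^sub>M (J i) (\<lambda>_. unif) \<rightarrow>\<^sub>M Pi\<^sub>M UNIV (\<lambda>n::nat. count_space UNIV)"
      by (rule measurable_compose[OF measurable_extend0])
  qed
  also have "(\<lambda>i \<omega>. (\<lambda>\<omega> n. elephant q i n (extend0 (J i) \<omega>)) (restrict (\<lambda>j. \<omega> j) (J i)))
    = (\<lambda>i \<omega> n. elephant q i n \<omega>)"
  proof (intro ext)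
    show "elephant q i n (extend0 (J i) (restrict (\<lambda>j. \<omega> j) (J i))) = elephant q i n \<omega>" for i n \<omega>
      by (rule elephant_cong) (simp add: extend0_def J_def)
  qed
  finally show ?thesis .
qed

lemma independent_erws_elephants:
  assumes q: "q \<in> {0..1}"
  shows "independent_erws noise i1 q (elephant q)"
  unfolding independent_erws_def
proof (intro conjI allI impI ballI erw_elephant[OF q] indep_vars_elephants noise.P.prob_space_axioms)
  have start: "elephant q i 1 \<omega> = sign_at i 0 0 0 \<omega>" for i \<omega>
    by (simp add: erw_bias_def)
  show "elephant q i1 1 \<omega> = 1" for \<omega>
    unfolding start by (simp add: sign_at_def)
  fix i assume "i \<noteq> i1"
  then show "\<P>(\<omega> in noise. elephant q i 1 \<omega> = 1) = 1 / 2" "\<P>(\<omega> in noise. elephant q i 1 \<omega> = - 1) = 1 / 2"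
    unfolding start using prob_sign_at[where h = 0 and \<epsilon> = 1 and i = i and k = 0 and x = 0]
      prob_sign_at[where h = 0 and \<epsilon> = "- 1" and i = i and k = 0 and x = 0] by simp_all
qed

lemma measurable_vec_lambda:
  fixes f :: "'d \<Rightarrow> 'a \<Rightarrow> int"
  assumes [measurable]: "\<And>i. f i \<in> M \<rightarrow>\<^sub>M count_space UNIV"
  shows "(\<lambda>x. \<chi> i. f i x) \<in> M \<rightarrow>\<^sub>M count_space UNIV"
proof (subst measurable_count_space_eq2_countable, intro conjI ballI)
  fix y :: "int ^ 'd"
  have "(\<lambda>x. \<chi> i. f i x) -` {y} \<inter> space M = {x \<in> space M. \<forall>i. f i x = y $ i}"
    by (auto simp: vec_eq_iff)
  also have "\<dots> \<in> sets M"
    by measurable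
  finally show "(\<lambda>x. \<chi> i. f i x) -` {y} \<inter> space M \<in> sets M" .
qed auto

text \<open>
  On the conditioning event the walk is a fixed function of the elephants. That event depends on the
  axis coordinates only and the elephants on the sign coordinates only, so conditioning leaves the law of
  the elephants as it is. Since the counts are the same for all biases, they may be those of any walk
  \<open>walk \<beta>\<close>.
\<close>

lemma distr_walk_given_counts:
  fixes \<beta> q n a
  defines "C \<equiv> counts_event noise (walk \<beta>) n a"
  assumes pos: "measure noise C > 0"
  shows "distr (uniform_measure noise C) (Pi\<^sub>M {1..n} (\<lambda>_. count_space UNIV))
      (\<lambda>\<omega>. \<lambda>m\<in>{1..n}. walk (erw_bias q) m \<omega>)
    = distr noise (Pi\<^sub>M {1..n} (\<lambda>_. count_space UNIV))
      (\<lambda>\<omega>. \<lambda>m\<in>{1..n}. \<chi> i. elephant q i (a m i) \<omega>)" (is "distr ?U ?P ?T = distr _ _ ?F")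
proof (rule measure_eqI)
  have C: "C = {\<omega>\<in>space noise. \<forall>m\<in>{1..n}. counts m \<omega> = a m}"
    unfolding C_def counts_event_def axis_count_walk by (simp add: fun_eq_iff)
  have [measurable]: "C \<in> sets noise"
    unfolding C by measurable
  have T [measurable]: "?T \<in> noise \<rightarrow>\<^sub>M ?P"
    by (rule measurable_restrict) (rule measurable_walk)
  have F [measurable]: "?F \<in> noise \<rightarrow>\<^sub>M ?P"
    by (rule measurable_restrict) (rule measurable_vec_lambda, rule measurable_elephant)
  fix A assume "A \<in> sets (distr ?U ?P ?T)"
  then have A [measurable]: "A \<in> sets ?P"
    by simp
  define G where "G = ?F -` A \<inter> space noise"
  have G [measurable]: "G \<in> sets noise"
    unfolding G_def by (rule measurable_sets[OF F A])
  have eq: "C \<inter> (?T -` A \<inter> space noise) = C \<inter> G"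
  proof -
    have "?T \<omega> = ?F \<omega>" if "\<omega> \<in> C" for \<omega>
    proof (rule restrict_ext)
      fix m assume "m \<in> {1..n}"
      with that have "counts m \<omega> = a m"
        unfolding C by blast
      then show "walk (erw_bias q) m \<omega> = (\<chi> i. elephant q i (a m i) \<omega>)"
        by (simp add: vec_eq_iff walk_erw_nth)
    qed
    then show ?thesis
      unfolding G_def by fastforce
  qed
  have "noise.P.prob (C \<inter> G) = noise.P.prob C * noise.P.prob G"
  proof (rule prob_indep)
    show "depends_on (range (\<lambda>m. src (Axis m))) C"
    proof (rule depends_onI)
      fix \<omega> \<omega>' assume \<omega>: "\<omega> \<in> C" and agree: "\<And>j. j \<in> range (\<lambda>m. src (Axis m)) \<Longrightarrow> \<omega>' j = \<omega> j"
      have "counts m \<omega>' = counts m \<omega>" for m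
        by (rule counts_cong, rule agree) simp
      with \<omega> show "\<omega>' \<in> C"
        unfolding C by simp
    qed
    show "depends_on (range (\<lambda>(i, k). src (Sign i k))) G"
    proof (rule depends_onI)
      fix \<omega> \<omega>' assume \<omega>: "\<omega> \<in> G" and agree: "\<And>j. j \<in> range (\<lambda>(i, k). src (Sign i k)) \<Longrightarrow> \<omega>' j = \<omega> j"
      have "elephant q i k \<omega>' = elephant q i k \<omega>" for i k
        by (rule elephant_cong, rule agree) auto
      then have "?F \<omega>' = ?F \<omega>"
        by (simp add: fun_eq_iff)
      with \<omega> show "\<omega>' \<in> G"
        unfolding G_def by simp
    qed
  qed auto
  then have law: "emeasure noise (C \<inter> G) = emeasure noise C * emeasure noise G"
    by (simp add: noise.P.emeasure_eq_measure ennreal_mult)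
  have "emeasure (distr ?U ?P ?T) A = emeasure ?U (?T -` A \<inter> space noise)"
    using T A by (subst emeasure_distr) auto
  also have "\<dots> = emeasure noise (C \<inter> (?T -` A \<inter> space noise)) / emeasure noise C"
    using measurable_sets[OF T A] by (intro emeasure_uniform_measure) auto
  also have "\<dots> = emeasure noise (C \<inter> G) / emeasure noise C"
    unfolding eq ..
  also have "\<dots> = emeasure noise G"
    unfolding law using pos
    by (subst ennreal_times_divide[symmetric], subst mult.commute)
       (simp add: noise.P.emeasure_eq_measure ennreal_divide_times ennreal_mult_divide_eq divide_ennreal ennreal_mult[symmetric])
  also have "\<dots> = emeasure (distr noise ?P ?F) A"
    unfolding G_def using F A by (subst emeasure_distr) auto
  finally show "emeasure (distr ?U ?P ?T) A = emeasure (distr noise ?P ?F) A" .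
qed simp

section \<open>Monotonicity in the bias\<close>

lemma abs_walk_mono:
  assumes odd: "\<And>n k x. \<beta> n k (- x) = - \<beta> n k x" "\<And>n k x. \<beta>' n k (- x) = - \<beta>' n k x"
    and le: "\<And>n k x. 0 < x \<Longrightarrow> x \<le> int k \<Longrightarrow> k \<le> n \<Longrightarrow> \<beta> n k x \<le> \<beta>' n k x"
  shows "\<bar>walk \<beta> n \<omega> $ i\<bar> \<le> \<bar>walk \<beta>' n \<omega> $ i\<bar>"
proof (induction n)
  case (Suc n)
  define k where "k = counts n \<omega> i"
  define x where "x = walk \<beta> n \<omega> $ i"
  define y where "y = walk \<beta>' n \<omega> $ i"
  have x: "\<bar>x\<bar> \<le> int k" and y: "\<bar>y\<bar> \<le> int k" and "k \<le> n"
    by (simp_all add: x_def y_def k_def abs_walk_le counts_le)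
  have xy: "\<bar>x\<bar> \<le> \<bar>y\<bar>"
    using Suc.IH by (simp add: x_def y_def)
  have "even (x + int k)" "even (y + int k)"
    unfolding x_def y_def k_def by (rule even_walk_counts)+
  then have parity: "even (x + y)"
    by presburger
  have "\<bar>x + sign_at i k (\<beta> n k x) x \<omega>\<bar> \<le> \<bar>y + sign_at i k (\<beta>' n k y) y \<omega>\<bar>"
  proof (cases "i = i1 \<and> k = 0")
    case True
    then show ?thesis
      using x y by (simp add: sign_at_def)
  next
    case False
    have "\<bar>x + turn (\<beta> n k x) x u\<bar> \<le> \<bar>y + turn (\<beta>' n k y) y u\<bar>" for u
    proof (rule turn_outward_mono[OF xy parity])
      show "\<beta> n k (- x) = - \<beta> n k x" "\<beta>' n k (- x) = - \<beta>' n k x"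
        by (rule odd)+
      show "\<beta> n k \<bar>x\<bar> \<le> \<beta>' n k \<bar>x\<bar>" if "x \<noteq> 0"
        using that x \<open>k \<le> n\<close> by (intro le) auto
    qed
    then show ?thesis
      by (simp only: sign_at_def False if_False)
  qed
  then show ?case
    using xy unfolding walk_Suc_nth x_def y_def k_def by (cases "i = axis_at n \<omega>") auto
qed simp

lemma erw_bias_uminus: "erw_bias q n k (- x) = - erw_bias q n k x"
  by (simp add: erw_bias_def)

lemma merw_bias_uminus: "merw_bias n k (- x) = - merw_bias n k x"
  by (simp add: merw_bias_def)

lemma erw_bias_mono:
  assumes "q \<le> q'" "0 < x"
  shows "erw_bias q n k x \<le> erw_bias q' n k x"
  unfolding erw_bias_def using assms by (intro divide_right_mono mult_right_mono) auto

lemma erw_bias_half: "erw_bias (1 / 2) n k x = 0"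
  by (simp add: erw_bias_def)

text \<open>
  The parameter at which the \<open>d\<close>-ERW has the bias that the MERW would have if all of its steps
  had been along one axis.
\<close>

definition critical :: real
  where "critical = (2 * real CARD('d) - 1) * p / (2 * real CARD('d) * p - 2 * p + 1)"

lemma critical_bias: "2 * critical - 1 = \<alpha> / (\<alpha> + \<gamma>)"
proof -
  have pos: "2 * real CARD('d) * p - 2 * p + 1 > 0"
    using \<alpha>_plus_\<gamma>_pos card_pos unfolding \<alpha>_plus_\<gamma> by (simp add: zero_less_divide_iff)
  have "2 * critical - 1 = (2 * real CARD('d) * p - 1) / (2 * real CARD('d) * p - 2 * p + 1)"
    using pos by (simp add: critical_def field_simps)
  also have "\<dots> = \<alpha> / (\<alpha> + \<gamma>)"
    unfolding \<alpha>_plus_\<gamma> using card_pos by (simp add: \<alpha>_def)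
  finally show ?thesis .
qed

text \<open>
  Both biases are \<open>\<alpha> * x / 2\<close> divided by positive numbers, namely \<open>(\<alpha> + \<gamma>) * k\<close> and \<open>\<alpha> * k + \<gamma> * n\<close>. The latter is the
  larger one since \<open>k \<le> n\<close>, so the bias of the MERW is the one closer to zero; its sign is that of
  \<open>\<alpha>\<close>.
\<close>

lemma merw_bias_critical:
  assumes x: "0 < x" "x \<le> int k" "k \<le> n"
  shows "\<alpha> \<le> 0 \<Longrightarrow> erw_bias critical n k x \<le> merw_bias n k x \<and> merw_bias n k x \<le> 0"
    and "\<alpha> \<ge> 0 \<Longrightarrow> 0 \<le> merw_bias n k x \<and> merw_bias n k x \<le> erw_bias critical n k x"
proof -
  define W where "W = \<alpha> * real k + \<gamma> * real n"
  have k: "real k > 0"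
    using x by simp
  have base: "(\<alpha> + \<gamma>) * real k > 0"
    using \<alpha>_plus_\<gamma>_pos k by simp
  have W: "(\<alpha> + \<gamma>) * real k \<le> W"
    using \<gamma>_nonneg x(3) by (simp add: W_def distrib_right mult_left_mono)
  have crit: "erw_bias critical n k x = of_int x / 2 * (\<alpha> / ((\<alpha> + \<gamma>) * real k))"
    by (simp add: erw_bias_def critical_bias mult_ac)
  have merw: "merw_bias n k x = of_int x / 2 * (\<alpha> / W)"
    by (simp add: merw_bias_def W_def)
  have x2: "(of_int x :: real) / 2 \<ge> 0"
    using x by simp
  show "erw_bias critical n k x \<le> merw_bias n k x \<and> merw_bias n k x \<le> 0" if "\<alpha> \<le> 0"
  proof
    show "erw_bias critical n k x \<le> merw_bias n k x"
      unfolding crit merw using W base that x2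
      by (intro mult_left_mono divide_left_mono_neg) (auto intro: mult_pos_pos less_le_trans)
    show "merw_bias n k x \<le> 0"
      unfolding merw using W base that x2 by (intro mult_nonneg_nonpos divide_nonpos_pos) auto
  qed
  show "0 \<le> merw_bias n k x \<and> merw_bias n k x \<le> erw_bias critical n k x" if "\<alpha> \<ge> 0"
  proof
    show "0 \<le> merw_bias n k x"
      unfolding merw using W base that x2 by (intro mult_nonneg_nonneg divide_nonneg_pos) auto
    show "merw_bias n k x \<le> erw_bias critical n k x"
      unfolding crit merw using W base that x2
      by (intro mult_left_mono divide_left_mono) (auto intro: mult_pos_pos less_le_trans)
  qed
qed

lemma \<alpha>_sign: "\<alpha> \<le> 0 \<longleftrightarrow> p \<le> 1 / (2 * real CARD('d))" "\<alpha> \<ge> 0 \<longleftrightarrow> p \<ge> 1 / (2 * real CARD('d))"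
  unfolding \<alpha>_def pos_divide_le_eq[OF card_pos] pos_le_divide_eq[OF card_pos]
  using card_ge_1 by (simp_all add: field_simps)

lemma abs_erw_walk_mono:
  assumes "q \<le> q'"
  shows "\<bar>walk (erw_bias q) n \<omega> $ i\<bar> \<le> \<bar>walk (erw_bias q') n \<omega> $ i\<bar>"
  using assms by (intro abs_walk_mono erw_bias_uminus erw_bias_mono)

lemma abs_merw_walk_between:
  assumes "p \<le> 1 / (2 * real CARD('d)) \<and> q1 \<le> critical \<and> q2 = 1 / 2
         \<or> p \<ge> 1 / (2 * real CARD('d)) \<and> q1 = 1 / 2 \<and> critical \<le> q2"
  shows "\<bar>walk (erw_bias q1) n \<omega> $ i\<bar> \<le> \<bar>walk merw_bias n \<omega> $ i\<bar>"
    and "\<bar>walk merw_bias n \<omega> $ i\<bar> \<le> \<bar>walk (erw_bias q2) n \<omega> $ i\<bar>"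
proof -
  have "erw_bias q1 n k x \<le> merw_bias n k x \<and> merw_bias n k x \<le> erw_bias q2 n k x"
    if x: "0 < x" "x \<le> int k" "k \<le> n" for n k x
    using assms
  proof (elim disjE conjE)
    assume *: "p \<le> 1 / (2 * real CARD('d))" "q1 \<le> critical" "q2 = 1 / 2"
    show ?thesis
      using merw_bias_critical(1)[OF x] erw_bias_mono[OF *(2) x(1), of n k] *(1)
      unfolding *(3) erw_bias_half by (auto simp: \<alpha>_sign)
  next
    assume *: "p \<ge> 1 / (2 * real CARD('d))" "q1 = 1 / 2" "critical \<le> q2"
    show ?thesis
      using merw_bias_critical(2)[OF x] erw_bias_mono[OF *(3) x(1), of n k] *(1)
      unfolding *(2) erw_bias_half by (auto simp: \<alpha>_sign)
  qed
  then show "\<bar>walk (erw_bias q1) n \<omega> $ i\<bar> \<le> \<bar>walk merw_bias n \<omega> $ i\<bar>"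
    and "\<bar>walk merw_bias n \<omega> $ i\<bar> \<le> \<bar>walk (erw_bias q2) n \<omega> $ i\<bar>"
    by (auto intro!: abs_walk_mono erw_bias_uminus merw_bias_uminus)
qed

end

theorem proposition1p11:
  fixes i1 :: "'d::finite" and p q1 q2 :: real
  assumes "p \<in> {0..1}" and "q1 \<in> {0..1}" and "q2 \<in> {0..1}"
  defines "d \<equiv> real CARD('d)"
  shows "\<exists>(M :: (nat \<Rightarrow> real) measure)
      (S :: nat \<Rightarrow> (nat \<Rightarrow> real) \<Rightarrow> int ^ 'd)
      (S1 :: nat \<Rightarrow> (nat \<Rightarrow> real) \<Rightarrow> int ^ 'd)
      (S2 :: nat \<Rightarrow> (nat \<Rightarrow> real) \<Rightarrow> int ^ 'd).
    prob_space M \<and>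
    nearest_neighbour M S \<and> nearest_neighbour M S1 \<and> nearest_neighbour M S2 \<and>
    (merw M i1 p S \<and> d_erw M i1 p q1 S1 \<and> d_erw M i1 p q2 S2) \<and>
    (\<forall>\<omega>\<in>space M. \<forall>n\<ge>1. \<forall>i.
      (S n \<omega> - S (n - 1) \<omega> \<in> axis_dirs i \<longleftrightarrow> S1 n \<omega> - S1 (n - 1) \<omega> \<in> axis_dirs i) \<and>
      (S1 n \<omega> - S1 (n - 1) \<omega> \<in> axis_dirs i \<longleftrightarrow> S2 n \<omega> - S2 (n - 1) \<omega> \<in> axis_dirs i)) \<and>
    (\<forall>\<omega>\<in>space M. \<forall>n\<ge>1. \<forall>i.
      axis_count (\<lambda>j. S j \<omega>) n i = axis_count (\<lambda>j. S1 j \<omega>) n i \<and>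
      axis_count (\<lambda>j. S1 j \<omega>) n i = axis_count (\<lambda>j. S2 j \<omega>) n i) \<and>
    (\<forall>(q, T) \<in> {(q1, S1), (q2, S2)}.
      \<exists>(N :: (nat \<Rightarrow> real) measure) (X :: 'd \<Rightarrow> nat \<Rightarrow> (nat \<Rightarrow> real) \<Rightarrow> int).
        independent_erws N i1 q X \<and>
        (\<forall>n\<ge>1. \<forall>a. measure M (counts_event M S n a) > 0 \<longrightarrow>
          distr (uniform_measure M (counts_event M S n a))
                (Pi\<^sub>M {1..n} (\<lambda>_. count_space UNIV))
                (\<lambda>\<omega>. \<lambda>m\<in>{1..n}. T m \<omega>)
          = distr N
                (Pi\<^sub>M {1..n} (\<lambda>_. count_space UNIV))
                (\<lambda>\<omega>. \<lambda>m\<in>{1..n}. \<chi> i. X i (a m i) \<omega>))) \<and>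
    (p \<le> 1 / (2 * d) \<and> q1 \<in> {0..(2 * d - 1) * p / (2 * d * p - 2 * p + 1)} \<and> q2 = 1 / 2
     \<or> p \<ge> 1 / (2 * d) \<and> q1 = 1 / 2 \<and> q2 \<in> {(2 * d - 1) * p / (2 * d * p - 2 * p + 1)..1} \<longrightarrow>
      (\<forall>\<omega>\<in>space M. \<forall>i n.
        \<bar>S1 n \<omega> $ i\<bar> \<le> \<bar>S n \<omega> $ i\<bar> \<and> \<bar>S n \<omega> $ i\<bar> \<le> \<bar>S2 n \<omega> $ i\<bar>)) \<and>
    (q1 \<le> q2 \<longrightarrow> (\<forall>\<omega>\<in>space M. \<forall>i n. \<bar>S1 n \<omega> $ i\<bar> \<le> \<bar>S2 n \<omega> $ i\<bar>))"
proof -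
  interpret coupling i1 p
    using assms(1) by unfold_locales auto
  let ?S = "walk merw_bias" and ?S1 = "walk (erw_bias q1)" and ?S2 = "walk (erw_bias q2)"
  have same_axes: "T n \<omega> - T (n - 1) \<omega> \<in> axis_dirs i \<longleftrightarrow> axis_at (n - 1) \<omega> = i"
    if "n \<ge> 1" "T = walk \<beta>" for T \<beta> n \<omega> i
    using walk_step_in_dirs[of \<beta> "n - 1" \<omega> i] that by (simp del: walk.simps)
  show ?thesis
  proof (rule exI[of _ noise], rule exI[of _ ?S], rule exI[of _ ?S1], rule exI[of _ ?S2],
      intro conjI nearest_neighbour_walk merw_walk d_erw_walk noise.P.prob_space_axioms)
    show "\<forall>\<omega>\<in>space noise. \<forall>n\<ge>1. \<forall>i.
      (?S n \<omega> - ?S (n - 1) \<omega> \<in> axis_dirs i \<longleftrightarrow> ?S1 n \<omega> - ?S1 (n - 1) \<omega> \<in> axis_dirs i) \<and>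
      (?S1 n \<omega> - ?S1 (n - 1) \<omega> \<in> axis_dirs i \<longleftrightarrow> ?S2 n \<omega> - ?S2 (n - 1) \<omega> \<in> axis_dirs i)"
      using same_axes[OF _ refl] by blast
    show "\<forall>\<omega>\<in>space noise. \<forall>n\<ge>1. \<forall>i.
      axis_count (\<lambda>j. ?S j \<omega>) n i = axis_count (\<lambda>j. ?S1 j \<omega>) n i \<and>
      axis_count (\<lambda>j. ?S1 j \<omega>) n i = axis_count (\<lambda>j. ?S2 j \<omega>) n i"
      by (simp add: axis_count_walk)
    have "\<exists>(N :: (nat \<Rightarrow> real) measure) (X :: 'd \<Rightarrow> nat \<Rightarrow> (nat \<Rightarrow> real) \<Rightarrow> int).
        independent_erws N i1 q X \<and>
        (\<forall>n\<ge>1. \<forall>a. measure noise (counts_event noise ?S n a) > 0 \<longrightarrow>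
          distr (uniform_measure noise (counts_event noise ?S n a)) (Pi\<^sub>M {1..n} (\<lambda>_. count_space UNIV))
            (\<lambda>\<omega>. \<lambda>m\<in>{1..n}. walk (erw_bias q) m \<omega>)
          = distr N (Pi\<^sub>M {1..n} (\<lambda>_. count_space UNIV)) (\<lambda>\<omega>. \<lambda>m\<in>{1..n}. \<chi> i. X i (a m i) \<omega>))"
      if "q \<in> {0..1}" for q
      using independent_erws_elephants[OF that] distr_walk_given_counts by blast
    then show "\<forall>(q, T) \<in> {(q1, ?S1), (q2, ?S2)}.
      \<exists>(N :: (nat \<Rightarrow> real) measure) (X :: 'd \<Rightarrow> nat \<Rightarrow> (nat \<Rightarrow> real) \<Rightarrow> int).
        independent_erws N i1 q X \<and>
        (\<forall>n\<ge>1. \<forall>a. measure noise (counts_event noise ?S n a) > 0 \<longrightarrow>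
          distr (uniform_measure noise (counts_event noise ?S n a)) (Pi\<^sub>M {1..n} (\<lambda>_. count_space UNIV))
            (\<lambda>\<omega>. \<lambda>m\<in>{1..n}. T m \<omega>)
          = distr N (Pi\<^sub>M {1..n} (\<lambda>_. count_space UNIV)) (\<lambda>\<omega>. \<lambda>m\<in>{1..n}. \<chi> i. X i (a m i) \<omega>))"
      using assms(2,3) by simp
    show "p \<le> 1 / (2 * d) \<and> q1 \<in> {0..(2 * d - 1) * p / (2 * d * p - 2 * p + 1)} \<and> q2 = 1 / 2
     \<or> p \<ge> 1 / (2 * d) \<and> q1 = 1 / 2 \<and> q2 \<in> {(2 * d - 1) * p / (2 * d * p - 2 * p + 1)..1} \<longrightarrow>
      (\<forall>\<omega>\<in>space noise. \<forall>i n. \<bar>?S1 n \<omega> $ i\<bar> \<le> \<bar>?S n \<omega> $ i\<bar> \<and> \<bar>?S n \<omega> $ i\<bar> \<le> \<bar>?S2 n \<omega> $ i\<bar>)"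
      using abs_merw_walk_between[of q1 q2] unfolding d_def critical_def by auto
    show "q1 \<le> q2 \<longrightarrow> (\<forall>\<omega>\<in>space noise. \<forall>i n. \<bar>?S1 n \<omega> $ i\<bar> \<le> \<bar>?S2 n \<omega> $ i\<bar>)"
      using abs_erw_walk_mono by blast
  qed (use assms(2,3) in auto)
qed

end
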